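(* Let $\alpha\in(0,2)$, let $Z$ be the standard isotropic $\alpha$-stable process in $\mathbb{C}$ with $Z_0=1$, and let $\theta$ be its winding process around $0$. Then, as $c\to0^+$, the family of processes $$\left(c^{-1/\alpha}\theta_{ct},\ t\ge 0\right)$$ converges in distribution on $D([0,\infty),\mathbb{R})$ endowed with the Skorohod topology to a symmetric one-dimensional $\alpha$-stable process $(\zeta_t,t\ge 0)$.
   Context: $Z=(Z_t,t\ge0)$ is the standard isotropic stable process of index $\alpha\in(0,2)$ in $\mathbb{C}\cong\mathbb{R}^2$ starting from $1$: it has stationary independent increments, cadlag paths, and $E[\exp(i\langle\lambda,Z_t-Z_0\rangle)]=\exp(-t|\lambda|^\alpha)$ for all $t\ge0$, $\lambda\in\mathbb{C}$, with $\langle\cdot,\cdot\rangle$ the Euclidean inner product. Almost surely $Z$ never visits $0$, $|Z_t|\to\infty$, and no jump segment of $Z$ contains $0$. Winding process $\theta=(\theta_t,t\ge0)$: on $[0,t]$, complete the path of $Z$ into a continuous curve in $\mathbb{C}\setminus\{0\}$ starting at $1$ by filling in each jump with the line segment $[Z_{s-},Z_s]$; $\theta_t$ is the total variation of the continuous determination of the argument along this curve (signed total angle wound around $0$). Equivalently, $\theta$ is the cadlag process with $\theta_0=0$, $\exp(i\theta_t)=Z_t/|Z_t|$ for all $t$, and all jumps of absolute value less than $\pi$. *)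

theory Defs
  imports "HOL-Probability.Probability"
begin

text \<open>Paths are functions on the reals of which only the values at times \<open>t \<ge> 0\<close> matter.\<close>

definition cadlag :: "(real \<Rightarrow> 'b::topological_space) \<Rightarrow> bool" where
  "cadlag x \<longleftrightarrow>
     (\<forall>t\<ge>0. (x \<longlongrightarrow> x t) (at_right t)) \<and> (\<forall>t>0. \<exists>l. (x \<longlongrightarrow> l) (at_left t))"


subsection \<open>The Skorohod space \<open>D([0,\<infinity>),\<real>)\<close>\<close>

text \<open>
  The topology is that of Billingsley's metric (Convergence of Probability Measures, 2nd ed.,
  Section 16).  On \<open>[0,m]\<close> one uses the distance
  \<open>inf\<^sub>l max (sup\<^sub>t \<bar>l t - t\<bar>) (sup\<^sub>t \<bar>x t - y (l t)\<bar>)\<close>, where \<open>l\<close> ranges over the increasing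
  homeomorphisms of \<open>[0,m]\<close>, truncated at \<open>1\<close>; below it is the infimum of \<open>1\<close> and of the common
  upper bounds \<open>e\<close> of the two suprema.  A path on \<open>[0,\<infinity>)\<close> is cut off continuously between \<open>m - 1\<close>
  and \<open>m\<close>, so that a jump at the time \<open>m\<close> does no harm, and the truncated distances for
  \<open>m = 1, 2, \<dots>\<close> are summed with weights \<open>1/2\<^sup>m\<close>.
\<close>

definition time_change :: "real \<Rightarrow> (real \<Rightarrow> real) \<Rightarrow> bool" where
  "time_change m l \<longleftrightarrow>
     continuous_on {0..m} l \<and> strict_mono_on {0..m} l \<and> l 0 = 0 \<and> l m = m"

definition skorohod_bounds :: "real \<Rightarrow> (real \<Rightarrow> real) \<Rightarrow> (real \<Rightarrow> real) \<Rightarrow> real set" where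
  "skorohod_bounds m x y =
     {e. \<exists>l. time_change m l \<and> (\<forall>t\<in>{0..m}. \<bar>l t - t\<bar> \<le> e \<and> \<bar>x t - y (l t)\<bar> \<le> e)}"

definition skorohod_dist_upto :: "real \<Rightarrow> (real \<Rightarrow> real) \<Rightarrow> (real \<Rightarrow> real) \<Rightarrow> real" where
  "skorohod_dist_upto m x y = Inf (insert 1 (skorohod_bounds m x y))"

definition cut_off :: "real \<Rightarrow> (real \<Rightarrow> real) \<Rightarrow> real \<Rightarrow> real" where
  "cut_off m x t = max 0 (min 1 (m - t)) * x t"

definition skorohod_dist :: "(real \<Rightarrow> real) \<Rightarrow> (real \<Rightarrow> real) \<Rightarrow> real" where
  "skorohod_dist x y =
     (\<Sum>k. (1/2) ^ Suc k *
        skorohod_dist_upto (real (Suc k)) (cut_off (real (Suc k)) x) (cut_off (real (Suc k)) y))"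

definition skorohod_space :: "(real \<Rightarrow> real) set" where
  "skorohod_space = {x \<in> extensional {0..}. cadlag x}"

lemma time_change_image:
  assumes "time_change m l" "0 \<le> m" shows "l ` {0..m} = {0..m}"
proof -
  have c: "continuous_on {0..m} l" and s: "strict_mono_on {0..m} l" and e: "l 0 = 0" "l m = m"
    using assms by (auto simp: time_change_def)
  have mono: "l u \<le> l v" if "u \<in> {0..m}" "v \<in> {0..m}" "u \<le> v" for u v
    using strict_mono_on_leD[OF s] that by blast
  have "l ` {0..m} \<subseteq> {0..m}"
    using mono[of 0] mono[of _ m] e assms(2) by fastforce
  moreover have "{0..m} \<subseteq> l ` {0..m}"
  proof
    fix y assume "y \<in> {0..m}"
    then obtain u where "0 \<le> u" "u \<le> m" "l u = y"
      using IVT'[of l 0 y m] c e assms(2) by auto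
    then show "y \<in> l ` {0..m}" by auto
  qed
  ultimately show ?thesis by blast
qed

lemma time_change_id: "time_change m (\<lambda>t. t)"
  by (auto simp: time_change_def strict_mono_on_def)

lemma time_change_comp:
  assumes "time_change m l" "time_change m k" "0 \<le> m" shows "time_change m (\<lambda>t. k (l t))"
proof -
  have i: "l ` {0..m} = {0..m}" by (rule time_change_image[OF assms(1,3)])
  have "continuous_on {0..m} (\<lambda>t. k (l t))"
    using continuous_on_compose2[of "{0..m}" k "{0..m}" l] assms i by (auto simp: time_change_def)
  moreover have "strict_mono_on {0..m} (\<lambda>t. k (l t))"
  proof (rule strict_mono_onI)
    fix r s assume rs: "r \<in> {0..m}" "s \<in> {0..m}" "r < s"
    then have "l r < l s" using assms(1) by (auto simp: time_change_def strict_mono_on_def)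
    moreover have "l r \<in> {0..m}" "l s \<in> {0..m}" using rs i by blast+
    ultimately show "k (l r) < k (l s)"
      using assms(2) unfolding time_change_def by (meson strict_mono_onD)
  qed
  ultimately show ?thesis using assms by (auto simp: time_change_def)
qed

lemma time_change_inverse:
  assumes "time_change m l" "0 \<le> m"
  obtains k where "time_change m k" "\<And>t. t \<in> {0..m} \<Longrightarrow> k t \<in> {0..m} \<and> l (k t) = t"
proof -
  define k where "k = inv_into {0..m} l"
  have i: "l ` {0..m} = {0..m}" by (rule time_change_image[OF assms])
  have s: "strict_mono_on {0..m} l" and c: "continuous_on {0..m} l"
    using assms(1) by (auto simp: time_change_def)
  have inj: "inj_on l {0..m}" using s by (rule strict_mono_on_imp_inj_on)
  have k: "k t \<in> {0..m} \<and> l (k t) = t" if "t \<in> {0..m}" for t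
    using that i inv_into_into[of t l "{0..m}"] f_inv_into_f[of t l "{0..m}"] by (auto simp: k_def)
  have kl: "k (l t) = t" if "t \<in> {0..m}" for t
    using that inj by (simp add: k_def)
  have "continuous_on {0..m} k"
    using continuous_on_inv[OF c, of k] kl i by simp
  moreover have "strict_mono_on {0..m} k"
  proof (rule strict_mono_onI)
    fix r t assume rt: "r \<in> {0..m}" "t \<in> {0..m}" "r < t"
    show "k r < k t"
    proof (rule ccontr)
      assume "\<not> k r < k t"
      then have "l (k t) \<le> l (k r)" using strict_mono_on_leD[OF s, of "k t" "k r"] k rt by auto
      then show False using k rt by auto
    qed
  qed
  moreover have "k 0 = 0" "k m = m"
    using kl[of 0] kl[of m] assms by (auto simp: time_change_def)
  ultimately have "time_change m k" by (simp add: time_change_def)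
  then show ?thesis using k that by blast
qed

lemma skorohod_bounds_nonneg: "e \<in> skorohod_bounds m x y \<Longrightarrow> 0 \<le> m \<Longrightarrow> 0 \<le> e"
  by (force simp: skorohod_bounds_def)

lemma skorohod_bounds_bdd_below: "0 \<le> m \<Longrightarrow> bdd_below (insert 1 (skorohod_bounds m x y))"
  by (auto intro!: bdd_belowI[of _ 0] dest: skorohod_bounds_nonneg)

lemma skorohod_dist_upto_nonneg: "0 \<le> m \<Longrightarrow> 0 \<le> skorohod_dist_upto m x y"
  unfolding skorohod_dist_upto_def by (rule cInf_greatest) (auto dest: skorohod_bounds_nonneg)

lemma skorohod_dist_upto_le:
  "0 \<le> m \<Longrightarrow> e \<in> insert 1 (skorohod_bounds m x y) \<Longrightarrow> skorohod_dist_upto m x y \<le> e"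
  unfolding skorohod_dist_upto_def by (rule cInf_lower[OF _ skorohod_bounds_bdd_below])

lemma skorohod_dist_upto_lessE:
  assumes "skorohod_dist_upto m x y < d"
  obtains e where "e \<in> insert 1 (skorohod_bounds m x y)" "e < d"
  using cInf_lessD[OF _ assms[unfolded skorohod_dist_upto_def]] by blast

lemma skorohod_dist_upto_same: "0 \<le> m \<Longrightarrow> skorohod_dist_upto m x x = 0"
proof -
  assume m: "0 \<le> m"
  have "0 \<in> skorohod_bounds m x x"
    using time_change_id by (force simp: skorohod_bounds_def)
  then show ?thesis using skorohod_dist_upto_le[OF m] skorohod_dist_upto_nonneg[OF m]
    by (metis insertCI order_antisym)
qed

lemma skorohod_bounds_sym:
  assumes "0 \<le> m" shows "skorohod_bounds m x y \<subseteq> skorohod_bounds m y x"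
proof
  fix e assume "e \<in> skorohod_bounds m x y"
  then obtain l where l: "time_change m l"
    and b: "\<And>t. t \<in> {0..m} \<Longrightarrow> \<bar>l t - t\<bar> \<le> e \<and> \<bar>x t - y (l t)\<bar> \<le> e"
    by (auto simp: skorohod_bounds_def)
  obtain k where k: "time_change m k" "\<And>t. t \<in> {0..m} \<Longrightarrow> k t \<in> {0..m} \<and> l (k t) = t"
    using time_change_inverse[OF l assms] by blast
  have "\<bar>k t - t\<bar> \<le> e \<and> \<bar>y t - x (k t)\<bar> \<le> e" if "t \<in> {0..m}" for t
    using b[of "k t"] k(2)[OF that] by (auto simp: abs_minus_commute)
  then show "e \<in> skorohod_bounds m y x" using k(1) by (auto simp: skorohod_bounds_def)
qed

lemma skorohod_dist_upto_sym: "0 \<le> m \<Longrightarrow> skorohod_dist_upto m x y = skorohod_dist_upto m y x"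
  using skorohod_bounds_sym[of m x y] skorohod_bounds_sym[of m y x]
  by (simp add: skorohod_dist_upto_def subset_antisym)

lemma skorohod_bounds_triangle:
  assumes "e \<in> skorohod_bounds m x y" "d \<in> skorohod_bounds m y z" "0 \<le> m"
  shows "e + d \<in> skorohod_bounds m x z"
proof -
  obtain l where l: "time_change m l"
    and b: "\<And>t. t \<in> {0..m} \<Longrightarrow> \<bar>l t - t\<bar> \<le> e \<and> \<bar>x t - y (l t)\<bar> \<le> e"
    using assms(1) by (auto simp: skorohod_bounds_def)
  obtain k where k: "time_change m k"
    and b': "\<And>t. t \<in> {0..m} \<Longrightarrow> \<bar>k t - t\<bar> \<le> d \<and> \<bar>y t - z (k t)\<bar> \<le> d"
    using assms(2) by (auto simp: skorohod_bounds_def)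
  have "\<bar>k (l t) - t\<bar> \<le> e + d \<and> \<bar>x t - z (k (l t))\<bar> \<le> e + d" if "t \<in> {0..m}" for t
  proof -
    have "l t \<in> {0..m}" using that time_change_image[OF l assms(3)] by blast
    from b'[OF this] b[OF that] show ?thesis by linarith
  qed
  then show ?thesis
    using time_change_comp[OF l k assms(3)]
    unfolding skorohod_bounds_def by (intro CollectI exI[of _ "\<lambda>t. k (l t)"]) blast
qed

lemma skorohod_dist_upto_triangle:
  assumes "0 \<le> m"
  shows "skorohod_dist_upto m x z \<le> skorohod_dist_upto m x y + skorohod_dist_upto m y z"
proof (rule field_le_epsilon)
  fix r :: real assume "0 < r"
  obtain e where e: "e \<in> insert 1 (skorohod_bounds m x y)" "e < skorohod_dist_upto m x y + r/2"
    using skorohod_dist_upto_lessE[of m x y "skorohod_dist_upto m x y + r/2"] \<open>0 < r\<close> by auto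
  obtain d where d: "d \<in> insert 1 (skorohod_bounds m y z)" "d < skorohod_dist_upto m y z + r/2"
    using skorohod_dist_upto_lessE[of m y z "skorohod_dist_upto m y z + r/2"] \<open>0 < r\<close> by auto
  have nn: "0 \<le> e" "0 \<le> d"
    using e(1) d(1) skorohod_bounds_nonneg assms by force+
  have "skorohod_dist_upto m x z \<le> e + d"
  proof (cases "e = 1 \<or> d = 1")
    case True
    then show ?thesis using skorohod_dist_upto_le[OF assms, of 1 x z] nn by auto
  next
    case False
    then show ?thesis
      using skorohod_dist_upto_le[OF assms] skorohod_bounds_triangle[OF _ _ assms] e(1) d(1) by simp
  qed
  then show "skorohod_dist_upto m x z \<le> skorohod_dist_upto m x y + skorohod_dist_upto m y z + r"
    using e d by linarith
qed

lemma skorohod_dist_summable: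
  "summable (\<lambda>k. (1/2) ^ Suc k *
     skorohod_dist_upto (real (Suc k)) (cut_off (real (Suc k)) x) (cut_off (real (Suc k)) y))"
proof (rule summable_comparison_test'[where N = 0])
  show "summable (\<lambda>k. (1/2 :: real) ^ Suc k)"
    using summable_Suc_iff summable_geometric[of "1/2 :: real"] by (simp add: summable_mult)
  show "norm ((1/2) ^ Suc n *
      skorohod_dist_upto (real (Suc n)) (cut_off (real (Suc n)) x) (cut_off (real (Suc n)) y))
     \<le> (1/2) ^ Suc n" for n
    using skorohod_dist_upto_nonneg[of "real (Suc n)" "cut_off (real (Suc n)) x" "cut_off (real (Suc n)) y"]
      skorohod_dist_upto_le[of "real (Suc n)" 1 "cut_off (real (Suc n)) x" "cut_off (real (Suc n)) y"]
    by (simp add: abs_mult mult_left_le)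
qed

lemma skorohod_dist_zero_imp_eq:
  assumes x: "x \<in> skorohod_space" and y: "y \<in> skorohod_space" and d: "skorohod_dist x y = 0"
  shows "x = y"
proof -
  have all: "skorohod_dist_upto (real (Suc k)) (cut_off (real (Suc k)) x) (cut_off (real (Suc k)) y) = 0" for k
    using suminf_eq_zero_iff[OF skorohod_dist_summable[of x y]] d
      skorohod_dist_upto_nonneg by (simp add: skorohod_dist_def)
  have near: "\<exists>s\<ge>0. \<bar>s - t\<bar> < e \<and> \<bar>x t - y s\<bar> < e" if "0 \<le> t" "0 < e" for t e
  proof -
    obtain k :: nat where k: "t + 2 < real (Suc k)" using reals_Archimedean2[of "t + 2"]
      by (metis less_Suc_eq of_nat_less_iff order_less_trans lessI)
    define m where "m = real (Suc k)"
    define d where "d = min 1 e"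
    have "skorohod_dist_upto m (cut_off m x) (cut_off m y) < d"
      using all[of k] that by (simp add: m_def d_def)
    then obtain r where r: "r \<in> insert 1 (skorohod_bounds m (cut_off m x) (cut_off m y))" "r < d"
      by (rule skorohod_dist_upto_lessE)
    then have "r \<in> skorohod_bounds m (cut_off m x) (cut_off m y)" by (auto simp: d_def)
    then obtain l where l: "time_change m l"
      and b: "\<And>t. t \<in> {0..m} \<Longrightarrow> \<bar>l t - t\<bar> \<le> r \<and> \<bar>cut_off m x t - cut_off m y (l t)\<bar> \<le> r"
      by (auto simp: skorohod_bounds_def)
    have tm: "t \<in> {0..m}" using that k by (simp add: m_def)
    have lt: "l t \<in> {0..m}" using time_change_image[OF l] tm by (auto simp: m_def)
    have "cut_off m x t = x t" using k by (simp add: cut_off_def m_def)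
    moreover have "1 \<le> m - l t"
    proof -
      have "\<bar>l t - t\<bar> \<le> r" "r < 1" using b[OF tm] r(2) by (auto simp: d_def)
      then show ?thesis using k unfolding m_def by linarith
    qed
    then have "cut_off m y (l t) = y (l t)" by (simp add: cut_off_def)
    ultimately show ?thesis using b[OF tm] r(2) lt by (auto intro!: exI[of _ "l t"] simp: d_def)
  qed
  have "x t = y t" if t: "0 \<le> t" for t
  proof (rule ccontr)
    assume "x t \<noteq> y t"
    define e where "e = \<bar>x t - y t\<bar> / 4"
    have e: "0 < e" using \<open>x t \<noteq> y t\<close> by (simp add: e_def)
    have "(x \<longlongrightarrow> x t) (at_right t)" "(y \<longlongrightarrow> y t) (at_right t)"
      using x y t by (auto simp: skorohod_space_def cadlag_def)
    from this[THEN tendstoD, OF e]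
    have "\<forall>\<^sub>F s in at_right t. \<bar>x s - x t\<bar> < e \<and> \<bar>y s - y t\<bar> < e"
      by (auto simp: dist_real_def intro: eventually_conj)
    then obtain b where b: "t < b" "\<And>s. t < s \<Longrightarrow> s < b \<Longrightarrow> \<bar>x s - x t\<bar> < e \<and> \<bar>y s - y t\<bar> < e"
      unfolding eventually_at_right_field by blast
    define u where "u = (t + b) / 2"
    have u: "t < u" "u < b" using b(1) by (auto simp: u_def)
    obtain s where s: "\<bar>s - u\<bar> < min e (min (u - t) (b - u))" "\<bar>x u - y s\<bar> < min e (min (u - t) (b - u))"
      using near[of u "min e (min (u - t) (b - u))"] u e t by auto
    then have "\<bar>x u - y s\<bar> < e" "\<bar>x u - x t\<bar> < e" "\<bar>y s - y t\<bar> < e"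
      using b(2)[of u] b(2)[of s] u by auto
    then have "\<bar>x t - y t\<bar> < 3 * e" by linarith
    then show False using e by (simp add: e_def)
  qed
  then show ?thesis
    using x y by (intro extensionalityI[of x "{0..}" y]) (auto simp: skorohod_space_def)
qed

lemma skorohod_Metric_space: "Metric_space skorohod_space skorohod_dist"
proof
  show "0 \<le> skorohod_dist x y" for x y
    unfolding skorohod_dist_def
    by (intro suminf_nonneg skorohod_dist_summable mult_nonneg_nonneg skorohod_dist_upto_nonneg) auto
  show "skorohod_dist x y = skorohod_dist y x" for x y
    unfolding skorohod_dist_def by (simp add: skorohod_dist_upto_sym)
  show "skorohod_dist x y = 0 \<longleftrightarrow> x = y" if "x \<in> skorohod_space" "y \<in> skorohod_space" for x y
    using skorohod_dist_zero_imp_eq[OF that] by (auto simp: skorohod_dist_def skorohod_dist_upto_same)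
  show "skorohod_dist x z \<le> skorohod_dist x y + skorohod_dist y z" for x y z
    unfolding skorohod_dist_def suminf_add[OF skorohod_dist_summable skorohod_dist_summable]
    by (intro suminf_le summable_add skorohod_dist_summable)
      (auto simp: distrib_left[symmetric] intro!: mult_left_mono skorohod_dist_upto_triangle)
qed

definition skorohod_topology :: "(real \<Rightarrow> real) topology" where
  "skorohod_topology = Metric_space.mtopology skorohod_space skorohod_dist"


subsection \<open>Convergence in distribution in a topological space\<close>

definition borel_of :: "'b topology \<Rightarrow> 'b measure" where
  "borel_of T = sigma (topspace T) {U. openin T U}"

definition weakly_converges ::
    "'b topology \<Rightarrow> ('i \<Rightarrow> 'b measure) \<Rightarrow> 'b measure \<Rightarrow> 'i filter \<Rightarrow> bool" where
  "weakly_converges T \<mu> \<nu> F \<longleftrightarrow>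
     (\<forall>f. continuous_map T euclideanreal f \<and> bounded (f ` topspace T) \<longrightarrow>
        ((\<lambda>i. \<integral>x. f x \<partial>\<mu> i) \<longlongrightarrow> (\<integral>x. f x \<partial>\<nu>)) F)"

text \<open>The measurability conditions ensure that the laws \<open>distr \<dots>\<close> are not junk values.\<close>

definition converges_in_distribution ::
    "'b topology \<Rightarrow> 'a measure \<Rightarrow> ('i \<Rightarrow> 'a \<Rightarrow> 'b) \<Rightarrow> 'c measure \<Rightarrow> ('c \<Rightarrow> 'b) \<Rightarrow> 'i filter \<Rightarrow> bool" where
  "converges_in_distribution T M X N Y F \<longleftrightarrow>
     (\<forall>\<^sub>F i in F. X i \<in> M \<rightarrow>\<^sub>M borel_of T) \<and> Y \<in> N \<rightarrow>\<^sub>M borel_of T \<and>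
     weakly_converges T (\<lambda>i. distr M (borel_of T) (X i)) (distr N (borel_of T) Y) F"


subsection \<open>Stable processes\<close>

text \<open>Independence of the initial value is not required: it is deterministic below.\<close>

locale levy_process = prob_space M
  for M :: "'a measure" and X :: "real \<Rightarrow> 'a \<Rightarrow> 'b::euclidean_space" +
  assumes random_variable_at: "\<And>t. 0 \<le> t \<Longrightarrow> random_variable borel (X t)"
    and independent_increments:
      "\<And>n (t :: nat \<Rightarrow> real). 0 \<le> t 0 \<Longrightarrow> (\<And>i. i < n \<Longrightarrow> t i \<le> t (Suc i)) \<Longrightarrow>
         indep_vars (\<lambda>_. borel) (\<lambda>i \<omega>. X (t (Suc i)) \<omega> - X (t i) \<omega>) {..<n}"
    and stationary_increments:
      "\<And>s t. 0 \<le> s \<Longrightarrow> 0 \<le> t \<Longrightarrow>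
         distr M borel (\<lambda>\<omega>. X (s + t) \<omega> - X s \<omega>) = distr M borel (\<lambda>\<omega>. X t \<omega> - X 0 \<omega>)"
    and cadlag_paths: "AE \<omega> in M. cadlag (\<lambda>t. X t \<omega>)"

text \<open>
  Increments with characteristic function \<open>exp (- t \<kappa> \<bar>u\<bar>\<^sup>\<alpha>)\<close> and starting point \<open>x\<close>.  For
  values in \<open>\<complex>\<close> and \<open>\<kappa> = 1\<close> this is the standard isotropic stable process; for real values and
  \<open>\<kappa> > 0\<close> it is the (nondegenerate) symmetric stable process with scale parameter \<open>\<kappa>\<close>.
\<close>

locale isotropic_stable_process = levy_process M X
  for M :: "'a measure" and \<alpha> \<kappa> :: real and x :: "'b::euclidean_space" and X :: "real \<Rightarrow> 'a \<Rightarrow> 'b" +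
  assumes start: "AE \<omega> in M. X 0 \<omega> = x"
    and characteristic_function:
      "\<And>t u. 0 \<le> t \<Longrightarrow>
         (CLINT \<omega>|M. iexp (u \<bullet> (X t \<omega> - X 0 \<omega>))) = of_real (exp (- t * \<kappa> * norm u powr \<alpha>))"


subsection \<open>The winding process around \<open>0\<close>\<close>

text \<open>
  Jumps of absolute value less than \<open>\<pi>\<close> correspond to filling in the jumps of \<open>z\<close> by line
  segments avoiding \<open>0\<close>.  Note that the second condition entails \<open>z t \<noteq> 0\<close>.
\<close>

definition winding_of :: "(real \<Rightarrow> complex) \<Rightarrow> (real \<Rightarrow> real) \<Rightarrow> bool" where
  "winding_of z \<theta> \<longleftrightarrow>
     cadlag \<theta> \<and> \<theta> 0 = 0 \<and>
     (\<forall>t\<ge>0. exp (\<i> * of_real (\<theta> t)) = z t / of_real (norm (z t))) \<and>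
     (\<forall>t>0. \<bar>\<theta> t - Lim (at_left t) \<theta>\<bar> < pi)"

text \<open>
  The winding process is defined almost surely; on the exceptional null set, where \<open>Z\<close> may hit
  \<open>0\<close>, its paths only have to be cadlag, so that it is \<open>D([0,\<infinity>),\<real>)\<close>-valued.
\<close>

definition winding_process ::
    "'a measure \<Rightarrow> (real \<Rightarrow> 'a \<Rightarrow> complex) \<Rightarrow> (real \<Rightarrow> 'a \<Rightarrow> real) \<Rightarrow> bool" where
  "winding_process M Z \<theta> \<longleftrightarrow>
     (\<forall>t\<ge>0. \<theta> t \<in> borel_measurable M) \<and>
     (\<forall>\<omega>\<in>space M. cadlag (\<lambda>t. \<theta> t \<omega>)) \<and>
     (AE \<omega> in M. winding_of (\<lambda>t. Z t \<omega>) (\<lambda>t. \<theta> t \<omega>))"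

end

theory Submission
  imports Defs
begin

text \<open>
  Until the process leaves a small disc around its starting point \<open>1\<close>, the winding angle is the
  principal argument, and at \<open>1 + y\<close> this is \<open>Im y + O(\<bar>y\<bar>\<^sup>2)\<close>. In time \<open>c\<close> the displacement is of
  order \<open>c\<^sup>1\<^sup>/\<^sup>\<alpha>\<close>. After division by \<open>c\<^sup>1\<^sup>/\<^sup>\<alpha>\<close> the quadratic error therefore vanishes, and what remains
  is the rescaled imaginary part of the displacement. By self-similarity its law does not depend on
  \<open>c\<close>. The limit is thus the imaginary part of the displacement itself, a symmetric stable process
  with scale parameter \<open>1\<close>.

  The deterministic estimate is \<open>abs_winding_diff_Im_le\<close>: the principal argument and the winding
  angle differ by a multiple of \<open>2\<pi>\<close> that cannot jump. Self-similarity is obtained from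
  \<open>stable_projection_rescale\<close> and \<open>stable_path_law_unique\<close>. It serves twice, as the law of the
  supremum of the rescaled real and imaginary parts, which bounds the displacement, is independent
  of \<open>c\<close> too.

  Convergence in distribution then follows from \<open>weakly_converges_of_close\<close>: processes close in
  probability to processes of a fixed law converge to this law. That the processes are random
  elements of the Skorohod space, and that the law of such an element is determined by its
  finite-dimensional distributions, rests on \<open>cadlag_process_measurable\<close>. There a cadlag path is
  approximated in the Skorohod metric by step functions taking its values at grid points. They
  depend continuously on countably many coordinates.
\<close>

section \<open>Oscillation of cadlag paths\<close>

lemma cadlag_small_oscillation:
  fixes x :: "real \<Rightarrow> real"
  assumes x: "cadlag x" and t: "0 \<le> t" and e: "0 < e"
  obtains d where "0 < d"
    "\<And>a b. 0 \<le> a \<Longrightarrow> a \<le> t \<Longrightarrow> t \<le> b \<Longrightarrow> b - a < d \<Longrightarrow>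
       (\<forall>u\<in>{a..<t}. \<forall>v\<in>{a..<t}. \<bar>x u - x v\<bar> \<le> e) \<and>
       (\<forall>u\<in>{t..<b}. \<forall>v\<in>{t..<b}. \<bar>x u - x v\<bar> \<le> e)"
proof -
  have "(x \<longlongrightarrow> x t) (at_right t)" using x t by (auto simp: cadlag_def)
  from tendstoD[OF this, of "e/2"] e obtain b1 where
    b1: "t < b1" "\<And>s. t < s \<Longrightarrow> s < b1 \<Longrightarrow> \<bar>x s - x t\<bar> < e/2"
    unfolding eventually_at_right_field by (auto simp: dist_real_def)
  have right: "\<bar>x u - x v\<bar> \<le> e" if "u \<in> {t..<b1}" "v \<in> {t..<b1}" for u v
  proof -
    have "\<bar>x u - x t\<bar> < e/2" "\<bar>x v - x t\<bar> < e/2"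
      using that b1(2)[of u] b1(2)[of v] e by (cases "u = t"; cases "v = t"; auto)+
    then show ?thesis by linarith
  qed
  have "\<exists>a1<t. \<forall>u v. 0 \<le> u \<longrightarrow> 0 \<le> v \<longrightarrow> a1 < u \<longrightarrow> u < t \<longrightarrow> a1 < v \<longrightarrow> v < t \<longrightarrow> \<bar>x u - x v\<bar> \<le> e"
  proof (cases "t = 0")
    case True
    then show ?thesis by (intro exI[of _ "-1"]) auto
  next
    case False
    with t have "0 < t" by simp
    with x obtain l where "(x \<longlongrightarrow> l) (at_left t)" unfolding cadlag_def by blast
    from tendstoD[OF this, of "e/2"] e obtain a1 where
      a1: "a1 < t" "\<And>s. a1 < s \<Longrightarrow> s < t \<Longrightarrow> \<bar>x s - l\<bar> < e/2"
      unfolding eventually_at_left_field by (auto simp: dist_real_def)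
    have "\<bar>x u - x v\<bar> \<le> e" if "a1 < u" "u < t" "a1 < v" "v < t" for u v
      using a1(2)[of u] a1(2)[of v] that by linarith
    with a1(1) show ?thesis by blast
  qed
  then obtain a1 where a1: "a1 < t"
    "\<And>u v. 0 \<le> u \<Longrightarrow> 0 \<le> v \<Longrightarrow> a1 < u \<Longrightarrow> u < t \<Longrightarrow> a1 < v \<Longrightarrow> v < t \<Longrightarrow> \<bar>x u - x v\<bar> \<le> e"
    by blast
  show thesis
  proof (rule that[of "min (b1 - t) (t - a1)"])
    show "0 < min (b1 - t) (t - a1)" using a1(1) b1(1) by simp
    fix a b assume "0 \<le> a" "a \<le> t" "t \<le> b" "b - a < min (b1 - t) (t - a1)"
    then show "(\<forall>u\<in>{a..<t}. \<forall>v\<in>{a..<t}. \<bar>x u - x v\<bar> \<le> e) \<and>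
       (\<forall>u\<in>{t..<b}. \<forall>v\<in>{t..<b}. \<bar>x u - x v\<bar> \<le> e)"
      using a1(2) right by auto
  qed
qed

lemma cadlag_bounded_on_interval:
  fixes x :: "real \<Rightarrow> real"
  assumes x: "cadlag x" and m: "0 \<le> m"
  obtains B where "0 \<le> B" "\<And>t. t \<in> {0..m} \<Longrightarrow> \<bar>x t\<bar> \<le> B"
proof -
  have "0 \<le> (0::real) \<longrightarrow> (\<exists>B. \<forall>u\<in>{0..m}. \<bar>x u\<bar> \<le> B)"
  proof (rule Bolzano[where P = "\<lambda>a b. 0 \<le> a \<longrightarrow> (\<exists>B. \<forall>u\<in>{a..b}. \<bar>x u\<bar> \<le> B)", OF m])
    fix a b c :: real
    assume "0 \<le> a \<longrightarrow> (\<exists>B. \<forall>u\<in>{a..b}. \<bar>x u\<bar> \<le> B)" "0 \<le> b \<longrightarrow> (\<exists>B. \<forall>u\<in>{b..c}. \<bar>x u\<bar> \<le> B)"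
      and ab: "a \<le> b" "b \<le> c"
    show "0 \<le> a \<longrightarrow> (\<exists>B. \<forall>u\<in>{a..c}. \<bar>x u\<bar> \<le> B)"
    proof
      assume "0 \<le> a"
      then obtain B1 B2 where "\<forall>u\<in>{a..b}. \<bar>x u\<bar> \<le> B1" "\<forall>u\<in>{b..c}. \<bar>x u\<bar> \<le> B2"
        using \<open>0 \<le> a \<longrightarrow> _\<close> \<open>0 \<le> b \<longrightarrow> _\<close> ab by (meson order_trans)
      then have "\<forall>u\<in>{a..c}. \<bar>x u\<bar> \<le> max B1 B2" by (auto simp: le_max_iff_disj)
      then show "\<exists>B. \<forall>u\<in>{a..c}. \<bar>x u\<bar> \<le> B" by blast
    qed
  next
    fix t :: real assume "0 \<le> t" "t \<le> m"
    obtain d where d: "0 < d"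
      "\<And>a b. 0 \<le> a \<Longrightarrow> a \<le> t \<Longrightarrow> t \<le> b \<Longrightarrow> b - a < d \<Longrightarrow>
         (\<forall>u\<in>{a..<t}. \<forall>v\<in>{a..<t}. \<bar>x u - x v\<bar> \<le> 1) \<and>
         (\<forall>u\<in>{t..<b}. \<forall>v\<in>{t..<b}. \<bar>x u - x v\<bar> \<le> 1)"
      using cadlag_small_oscillation[OF x \<open>0 \<le> t\<close>, of 1] by auto
    have "\<forall>u\<in>{a..b}. \<bar>x u\<bar> \<le> 1 + \<bar>x a\<bar> + \<bar>x t\<bar> + \<bar>x b\<bar>"
      if "0 \<le> a" "a \<le> t" "t \<le> b" "b - a < d" for a b
    proof
      fix u assume u: "u \<in> {a..b}"
      note D = d(2)[OF that]
      consider "u < t" | "t \<le> u" "u < b" | "u = b" using u by fastforce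
      then show "\<bar>x u\<bar> \<le> 1 + \<bar>x a\<bar> + \<bar>x t\<bar> + \<bar>x b\<bar>"
      proof cases
        case 1
        then have "\<bar>x u - x a\<bar> \<le> 1" using D u that by auto
        then show ?thesis by linarith
      next
        case 2
        then have "\<bar>x u - x t\<bar> \<le> 1" using D u that by auto
        then show ?thesis by linarith
      qed simp
    qed
    then show "\<exists>d>0. \<forall>a b. a \<le> t \<and> t \<le> b \<and> b - a < d \<longrightarrow>
        (0 \<le> a \<longrightarrow> (\<exists>B. \<forall>u\<in>{a..b}. \<bar>x u\<bar> \<le> B))"
      using d(1) by blast
  qed
  then obtain B where B: "\<And>t. t \<in> {0..m} \<Longrightarrow> \<bar>x t\<bar> \<le> B" by (metis order_refl)
  moreover have "0 \<le> B" using B[of 0] m by (auto intro: order_trans[OF abs_ge_zero])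
  ultimately show thesis by (intro that[of B]) auto
qed

section \<open>Step functions on a grid approximate cadlag paths\<close>

definition grid_ceiling :: "nat \<Rightarrow> real \<Rightarrow> real" where
  "grid_ceiling n s = real_of_int \<lceil>real n * s\<rceil> / real n"

definition grid_floor :: "nat \<Rightarrow> real \<Rightarrow> real" where
  "grid_floor n s = real_of_int \<lfloor>real n * s\<rfloor> / real n"

lemma grid_ceiling_bounds:
  assumes "0 < n" shows "s \<le> grid_ceiling n s" "grid_ceiling n s < s + 1 / real n"
proof -
  have "real n * s \<le> real_of_int \<lceil>real n * s\<rceil>" "real_of_int \<lceil>real n * s\<rceil> < real n * s + 1"
    by linarith+
  then show "s \<le> grid_ceiling n s" "grid_ceiling n s < s + 1 / real n"
    using assms by (auto simp: grid_ceiling_def field_simps)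
qed

text \<open>A grid point before \<^term>\<open>grid_ceiling n s\<close>, the first grid point from \<open>s\<close> on, lies before
  \<open>s\<close> itself. So times between the grid points following \<open>r\<close> and \<open>s\<close> are rounded down
  to times in \<open>[r, s)\<close>, where the oscillation of a path can be controlled.\<close>

lemma grid_floor_between:
  assumes n: "0 < n" and u: "grid_ceiling n r \<le> u" "u < grid_ceiling n s"
  shows "r \<le> grid_floor n u" "grid_floor n u < s"
proof -
  have "real_of_int \<lceil>real n * r\<rceil> \<le> real n * u"
    using u(1) n by (simp add: grid_ceiling_def field_simps)
  then have "\<lceil>real n * r\<rceil> \<le> \<lfloor>real n * u\<rfloor>" by (simp add: le_floor_iff)
  then have "real n * r \<le> real_of_int \<lfloor>real n * u\<rfloor>" by (simp add: ceiling_le_iff)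
  then show "r \<le> grid_floor n u" using n by (simp add: grid_floor_def field_simps)
  have "real n * u < real_of_int \<lceil>real n * s\<rceil>"
    using u(2) n by (simp add: grid_ceiling_def field_simps)
  then have "\<lfloor>real n * u\<rfloor> < \<lceil>real n * s\<rceil>" by (simp add: floor_less_iff)
  then have "real_of_int \<lfloor>real n * u\<rfloor> < real n * s" by (simp add: less_ceiling_iff)
  then show "grid_floor n u < s" using n by (simp add: grid_floor_def field_simps)
qed

text \<open>A time change of \<open>[0,s]\<close> onto the interval up to the next grid point, after which the step
  function with the values of \<open>x\<close> at the grid points follows \<open>x\<close> within \<open>e\<close>. The closeness is
  restricted to times before \<open>s\<close>, since \<open>x\<close> may jump at \<open>s\<close>; the next interval takes
  care of this jump.\<close>

definition grid_aligned :: "nat \<Rightarrow> (real \<Rightarrow> real) \<Rightarrow> real \<Rightarrow> real \<Rightarrow> (real \<Rightarrow> real) \<Rightarrow> bool" where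
  "grid_aligned n x e s l \<longleftrightarrow>
     continuous_on {0..s} l \<and> strict_mono_on {0..s} l \<and> l 0 = 0 \<and> l s = grid_ceiling n s \<and>
     (\<forall>t\<in>{0..<s}. \<bar>l t - t\<bar> \<le> 1 / real n \<and> \<bar>x t - x (grid_floor n (l t))\<bar> \<le> e)"

text \<open>The time change is continued linearly from \<open>r\<close> to \<open>s\<close>. It increases strictly because
  an interval longer than the mesh \<open>1/n\<close> separates the next grid points of its end points.\<close>

lemma grid_aligned_extend:
  assumes n: "0 < n" and rs: "0 \<le> r" "1 < real n * (s - r)"
    and l: "grid_aligned n x e r l"
    and osc: "\<forall>u\<in>{r..<s}. \<forall>v\<in>{r..<s}. \<bar>x u - x v\<bar> \<le> e"
  shows "\<exists>l. grid_aligned n x e s l"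
proof -
  define g where "g = grid_ceiling n"
  define k where "k t = g r + (t - r) * ((g s - g r) / (s - r))" for t
  define l' where "l' t = (if t \<le> r then l t else k t)" for t
  have "r < s" using rs n by (metis diff_gt_0_iff_gt less_trans of_nat_0_less_iff zero_less_mult_pos zero_less_one)
  have gb: "s \<le> g s" "g s < s + 1 / real n" "r \<le> g r" "g r < r + 1 / real n"
    using grid_ceiling_bounds[OF n] by (auto simp: g_def)
  have "r + 1 / real n < s" using rs n by (simp add: field_simps)
  then have slope: "0 < (g s - g r) / (s - r)" (is "0 < ?c")
    using gb \<open>r < s\<close> by (intro divide_pos_pos) auto
  have kr: "k r = g r" and ks: "k s = g s" using \<open>r < s\<close> by (auto simp: k_def)
  have kmono: "k u < k v" if "u < v" for u v
    unfolding k_def using that slope by (intro add_strict_left_mono mult_strict_right_mono) auto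
  have lr: "l r = g r" and lc: "continuous_on {0..r} l" and lm: "strict_mono_on {0..r} l"
    and l0: "l 0 = 0" and lt: "\<And>t. 0 \<le> t \<Longrightarrow> t < r \<Longrightarrow>
      \<bar>l t - t\<bar> \<le> 1 / real n \<and> \<bar>x t - x (grid_floor n (l t))\<bar> \<le> e"
    using l by (auto simp: grid_aligned_def g_def)
  have "{0..s} = {0..r} \<union> {r..s}" using rs \<open>r < s\<close> by auto
  moreover have "continuous_on ({0..r} \<union> {r..s}) l'"
    unfolding l'_def
    by (intro continuous_on_cases lc) (auto simp: k_def lr intro!: continuous_intros, use \<open>r < s\<close> in auto)
  moreover have "strict_mono_on {0..s} l'"
  proof (rule strict_mono_onI)
    fix u v assume uv: "u \<in> {0..s}" "v \<in> {0..s}" "u < v"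
    have 1: "l u \<le> l r" if "u \<le> r" using strict_mono_on_leD[OF lm, of u r] that uv rs by auto
    show "l' u < l' v"
      using uv 1 kmono[of r v] kmono[of u v] strict_mono_onD[OF lm, of u v]
      by (auto simp: l'_def lr kr)
  qed
  moreover have "l' 0 = 0" "l' s = grid_ceiling n s"
    using rs l0 ks \<open>r < s\<close> by (auto simp: l'_def g_def)
  moreover have "\<bar>l' t - t\<bar> \<le> 1 / real n \<and> \<bar>x t - x (grid_floor n (l' t))\<bar> \<le> e"
    if "t \<in> {0..<s}" for t
  proof (cases "t < r")
    case True
    then show ?thesis using lt[of t] that by (simp add: l'_def)
  next
    case False
    then have t: "r \<le> t" "t < s" and l': "l' t = k t" using that lr kr by (auto simp: l'_def)
    have kt: "g r \<le> k t" "k t < g s"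
      using kmono[of r t] kmono[of t s] kr ks t by (cases "t = r"; auto)+
    then have "r \<le> grid_floor n (k t)" "grid_floor n (k t) < s"
      using grid_floor_between[OF n] by (auto simp: g_def)
    then have "\<bar>x t - x (grid_floor n (l' t))\<bar> \<le> e" using osc t by (simp add: l')
    moreover have "\<bar>k t - t\<bar> \<le> 1 / real n"
    proof -
      define w where "w = (t - r) / (s - r)"
      have w: "0 \<le> w" "w \<le> 1" using t by (auto simp: w_def)
      have "k t = (1 - w) * g r + w * g s" by (simp add: k_def w_def algebra_simps diff_divide_distrib)
      moreover have "t = (1 - w) * r + w * s"
      proof -
        have "w * (s - r) = t - r" using \<open>r < s\<close> by (simp add: w_def)
        then show ?thesis by (simp add: algebra_simps)
      qed
      ultimately have "k t - t = ((1 - w) * g r + w * g s) - ((1 - w) * r + w * s)" by metis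
      also have "\<dots> = (1 - w) * (g r - r) + w * (g s - s)" by (simp add: algebra_simps)
      finally have "k t - t = (1 - w) * (g r - r) + w * (g s - s)" .
      moreover have "0 \<le> (1 - w) * (g r - r)" "0 \<le> w * (g s - s)" using w gb by auto
      moreover have "(1 - w) * (g r - r) + w * (g s - s) \<le> (1 - w) * (1 / real n) + w * (1 / real n)"
        using w gb by (intro add_mono mult_left_mono) auto
      moreover have "\<dots> = 1 / real n" by (simp flip: add_divide_distrib)
      ultimately show ?thesis by linarith
    qed
    ultimately show ?thesis by (simp add: l')
  qed
  ultimately show ?thesis
    unfolding grid_aligned_def by (intro exI[of _ l']) auto
qed

text \<open>Alignability propagates across every point, since just before and just after it the path
  oscillates by at most \<open>e\<close>; a continuous induction then covers the whole interval. This replaces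
  the usual choice of a finite partition into intervals of small oscillation.\<close>

lemma eventually_grid_aligned:
  fixes x :: "real \<Rightarrow> real"
  assumes x: "cadlag x" and e: "0 < e" and m: "0 \<le> m"
  shows "\<forall>\<^sub>F n in sequentially. \<exists>l. grid_aligned n x e m l"
proof -
  define good where "good s \<longleftrightarrow> (\<forall>\<^sub>F n in sequentially. \<exists>l. grid_aligned n x e s l)" for s
  have extend: "good s" if "good r" "0 \<le> r" "r \<le> s"
    and osc: "\<forall>u\<in>{r..<s}. \<forall>v\<in>{r..<s}. \<bar>x u - x v\<bar> \<le> e" for r s
  proof (cases "r = s")
    case False
    have "filterlim (\<lambda>n. real n * (s - r)) at_top sequentially"
      using False that
      by (intro filterlim_at_top_mult_tendsto_pos[where c = "s - r"] tendsto_const filterlim_real_sequentially) auto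
    then have "\<forall>\<^sub>F n in sequentially. 1 < real n * (s - r)"
      by (simp add: filterlim_at_top_dense)
    with \<open>good r\<close> show ?thesis
      unfolding good_def using eventually_gt_at_top[of 0]
      by eventually_elim (use grid_aligned_extend osc that in blast)
  qed (use that in simp)
  have "good 0"
    unfolding good_def using eventually_gt_at_top[of 0]
    by eventually_elim
      (auto simp: grid_aligned_def grid_ceiling_def strict_mono_on_def intro!: exI[of _ "\<lambda>t. t"])
  moreover have "0 \<le> (0::real) \<and> good 0 \<longrightarrow> good m"
  proof (rule Bolzano[where P = "\<lambda>a b. 0 \<le> a \<and> good a \<longrightarrow> good b", OF m])
    fix t :: real assume t: "0 \<le> t" "t \<le> m"
    obtain d where d: "0 < d"
      "\<And>a b. 0 \<le> a \<Longrightarrow> a \<le> t \<Longrightarrow> t \<le> b \<Longrightarrow> b - a < d \<Longrightarrow>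
         (\<forall>u\<in>{a..<t}. \<forall>v\<in>{a..<t}. \<bar>x u - x v\<bar> \<le> e) \<and>
         (\<forall>u\<in>{t..<b}. \<forall>v\<in>{t..<b}. \<bar>x u - x v\<bar> \<le> e)"
      using cadlag_small_oscillation[OF x t(1) e] by auto
    have "good b" if "0 \<le> a" "a \<le> t" "t \<le> b" "b - a < d" "good a" for a b
      using d(2)[OF that(1-4)] extend[of a t] extend[of t b] that t by blast
    then show "\<exists>d>0. \<forall>a b. a \<le> t \<and> t \<le> b \<and> b - a < d \<longrightarrow> (0 \<le> a \<and> good a \<longrightarrow> good b)"
      using d(1) by blast
  qed auto
  ultimately show ?thesis by (simp add: good_def)
qed

section \<open>Estimates for the Skorohod distance\<close>

text \<open>The distances being truncated at \<open>1\<close>, the terms of the series from \<open>T\<close> on contribute at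
  most \<open>1/2\<^sup>T\<close>.\<close>

lemma skorohod_dist_le_of_initial:
  assumes e: "0 \<le> e"
    and close: "\<And>k. k < T \<Longrightarrow> skorohod_dist_upto (real (Suc k)) (cut_off (real (Suc k)) x) (cut_off (real (Suc k)) y) \<le> e"
  shows "skorohod_dist x y \<le> e + (1/2) ^ T"
proof -
  define w :: "nat \<Rightarrow> real" where "w k = (1/2) ^ Suc k" for k
  define D where "D k = skorohod_dist_upto (real (Suc k)) (cut_off (real (Suc k)) x) (cut_off (real (Suc k)) y)" for k
  have wsum: "w sums 1" unfolding w_def by (rule power_half_series)
  have D1: "D k \<le> 1" for k unfolding D_def by (rule skorohod_dist_upto_le) auto
  have tail: "(\<lambda>k. if k < T then 0 else w k) sums ((1/2) ^ T)"
  proof -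
    have "(\<lambda>k. w (k + T)) sums ((1/2) ^ T * 1)"
      using sums_mult[OF wsum, of "(1/2)^T"] by (simp add: w_def power_add mult.commute mult.left_commute)
    then show ?thesis
      using sums_iff_shift[of "\<lambda>k. if k < T then 0 else w k" T "(1/2) ^ T"] by simp
  qed
  have head: "(\<lambda>k. e * w k) sums e" using sums_mult[OF wsum, of e] by simp
  have "skorohod_dist x y = (\<Sum>k. w k * D k)" by (simp add: skorohod_dist_def w_def D_def)
  also have "\<dots> \<le> (\<Sum>k. e * w k + (if k < T then 0 else w k))"
  proof (rule suminf_le)
    show "w k * D k \<le> e * w k + (if k < T then 0 else w k)" for k
      using close[of k] D1[of k] e by (auto simp: D_def w_def intro!: mult_left_le add_increasing)
    show "summable (\<lambda>k. w k * D k)"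
      using skorohod_dist_summable[of x y] by (simp add: w_def D_def)
    show "summable (\<lambda>k. e * w k + (if k < T then 0 else w k))"
      using sums_add[OF head tail] by (rule sums_summable)
  qed
  also have "\<dots> = e + (1/2) ^ T" using sums_add[OF head tail] by (rule sums_unique[symmetric])
  finally show ?thesis .
qed

lemma skorohod_dist_le_uniform:
  assumes e: "0 \<le> e" and close: "\<And>t. 0 \<le> t \<Longrightarrow> t < real T \<Longrightarrow> \<bar>x t - y t\<bar> \<le> e"
  shows "skorohod_dist x y \<le> e + (1/2) ^ T"
proof (rule skorohod_dist_le_of_initial[OF e])
  fix k assume k: "k < T"
  let ?m = "real (Suc k)"
  have "\<bar>cut_off ?m x t - cut_off ?m y t\<bar> \<le> e" if "t \<in> {0..?m}" for t
  proof (cases "t = ?m")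
    case False
    then have "\<bar>x t - y t\<bar> \<le> e" using that k by (intro close) (auto simp: less_le)
    moreover have "cut_off ?m x t - cut_off ?m y t = max 0 (min 1 (?m - t)) * (x t - y t)"
      by (simp add: cut_off_def algebra_simps)
    moreover have "\<bar>max 0 (min 1 (?m - t))\<bar> * \<bar>x t - y t\<bar> \<le> 1 * \<bar>x t - y t\<bar>"
      by (intro mult_right_mono) auto
    ultimately show ?thesis by (simp add: abs_mult)
  qed (simp add: cut_off_def e)
  then have "e \<in> skorohod_bounds ?m (cut_off ?m x) (cut_off ?m y)"
    unfolding skorohod_bounds_def using time_change_id[of ?m] e
    by (intro CollectI exI[of _ "\<lambda>t. t"]) auto
  then show "skorohod_dist_upto ?m (cut_off ?m x) (cut_off ?m y) \<le> e"
    by (intro skorohod_dist_upto_le) auto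
qed

text \<open>The end point \<open>m = Suc k\<close> is a grid point, so that an alignment on \<open>[0,m]\<close> is a time change of
  \<open>[0,m]\<close>. At the time \<open>m\<close>, which an alignment leaves out, both cut off paths vanish. Before it,
  moving the cut-off factor by the time change costs at most \<open>1/n\<close> times a bound for the path.\<close>

lemma eventually_skorohod_dist_upto_grid_step_le:
  fixes x :: "real \<Rightarrow> real"
  assumes x: "cadlag x" and e: "0 < e"
    and y: "\<And>n t. 0 \<le> t \<Longrightarrow> y n t = x (grid_floor n t)"
  shows "\<forall>\<^sub>F n in sequentially. skorohod_dist_upto (real (Suc k)) (cut_off (real (Suc k)) x) (cut_off (real (Suc k)) (y n)) \<le> e"
proof -
  let ?m = "real (Suc k)"
  obtain B where B: "0 \<le> B" "\<And>t. t \<in> {0..?m} \<Longrightarrow> \<bar>x t\<bar> \<le> B"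
    using cadlag_bounded_on_interval[OF x, of ?m] by auto
  have "(\<lambda>n. e/2 + 1 / real n * B) \<longlonglongrightarrow> e/2 + 0 * B"
    by (intro tendsto_add tendsto_mult tendsto_const lim_1_over_n)
  then have 1: "\<forall>\<^sub>F n in sequentially. e/2 + 1 / real n * B < e"
    by (rule order_tendstoD(2)) (use e in simp)
  have 2: "\<forall>\<^sub>F n in sequentially. 1 / real n < e"
    by (rule order_tendstoD(2)[OF lim_1_over_n e])
  from eventually_grid_aligned[OF x, of "e/2" ?m] e
  have 3: "\<forall>\<^sub>F n in sequentially. \<exists>l. grid_aligned n x (e/2) ?m l" by simp
  show ?thesis using 1 2 3 eventually_gt_at_top[of 0]
  proof eventually_elim
    case (elim n)
    then obtain l where l: "grid_aligned n x (e/2) ?m l" by blast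
    have gm: "grid_ceiling n ?m = ?m"
    proof -
      have "real_of_int \<lceil>real n * ?m\<rceil> = real n * ?m"
        by (metis ceiling_of_nat of_int_of_nat_eq of_nat_mult)
      then show ?thesis unfolding grid_ceiling_def using elim by (simp only:) simp
    qed
    then have tc: "time_change ?m l" using l by (simp add: grid_aligned_def time_change_def)
    have lim: "l t \<in> {0..?m}" if "t \<in> {0..?m}" for t
      using time_change_image[OF tc] that by auto
    have "\<bar>l t - t\<bar> \<le> e \<and> \<bar>cut_off ?m x t - cut_off ?m (y n) (l t)\<bar> \<le> e" if t: "t \<in> {0..?m}" for t
    proof (cases "t = ?m")
      case True
      then show ?thesis using tc e by (simp add: time_change_def cut_off_def)
    next
      case False
      define a b where "a = max 0 (min 1 (?m - t))" and "b = max 0 (min 1 (?m - l t))"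
      have d: "\<bar>l t - t\<bar> \<le> 1 / real n" "\<bar>x t - x (grid_floor n (l t))\<bar> \<le> e/2"
        using l False t by (auto simp: grid_aligned_def)
      have yt: "y n (l t) = x (grid_floor n (l t))" using lim[OF t] by (intro y) auto
      have ab: "\<bar>b - a\<bar> \<le> 1 / real n" "\<bar>b\<bar> \<le> 1" using d(1) by (auto simp: a_def b_def)
      have "cut_off ?m x t - cut_off ?m (y n) (l t) = b * (x t - y n (l t)) - (b - a) * x t"
        by (simp add: cut_off_def a_def b_def algebra_simps)
      also have "\<bar>\<dots>\<bar> \<le> \<bar>b\<bar> * \<bar>x t - y n (l t)\<bar> + \<bar>b - a\<bar> * \<bar>x t\<bar>"
        by (metis abs_mult abs_triangle_ineq4)
      also have "\<dots> \<le> 1 * (e/2) + 1 / real n * B"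
        using ab d B t yt by (intro add_mono mult_mono) auto
      finally show ?thesis using d elim by linarith
    qed
    then have "e \<in> skorohod_bounds ?m (cut_off ?m x) (cut_off ?m (y n))"
      using tc by (auto simp: skorohod_bounds_def)
    then show ?case by (intro skorohod_dist_upto_le) auto
  qed
qed

lemma skorohod_dist_grid_step_tendsto:
  fixes x :: "real \<Rightarrow> real"
  assumes x: "cadlag x" and y: "\<And>n t. 0 \<le> t \<Longrightarrow> y n t = x (grid_floor n t)"
  shows "(\<lambda>n. skorohod_dist (y n) x) \<longlonglongrightarrow> 0"
proof (rule order_tendstoI)
  interpret Metric_space skorohod_space skorohod_dist by (rule skorohod_Metric_space)
  show "\<forall>\<^sub>F n in sequentially. a < skorohod_dist (y n) x" if "a < 0" for a
    using that nonneg by (simp add: less_le_trans)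
  fix a :: real assume a: "0 < a"
  obtain T where T: "(1/2 :: real) ^ T < a/2" using real_arch_pow_inv[of "a/2" "1/2"] a by auto
  have "\<forall>\<^sub>F n in sequentially. \<forall>k<T.
      skorohod_dist_upto (real (Suc k)) (cut_off (real (Suc k)) x) (cut_off (real (Suc k)) (y n)) \<le> a/2"
    unfolding lessThan_iff[symmetric] Ball_def[symmetric]
    using a by (intro eventually_ball_finite ballI eventually_skorohod_dist_upto_grid_step_le[OF x _ y]) auto
  then show "\<forall>\<^sub>F n in sequentially. skorohod_dist (y n) x < a"
  proof eventually_elim
    case (elim n)
    then have "skorohod_dist x (y n) \<le> a/2 + (1/2) ^ T"
      using a by (intro skorohod_dist_le_of_initial) auto
    then show ?case using T commute[of x "y n"] by linarith
  qed
qed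

section \<open>Cadlag processes are random elements of the Skorohod space\<close>

lemma space_borel_of [simp]: "space (borel_of T) = topspace T"
  unfolding borel_of_def by (rule space_measure_of) (auto dest: openin_subset)

lemma sets_borel_of_openin: "openin T U \<Longrightarrow> U \<in> sets (borel_of T)"
  unfolding borel_of_def by (subst sets_measure_of) (auto dest: openin_subset)

lemma measurable_borel_ofI:
  assumes "f \<in> space M \<rightarrow> topspace T" "\<And>U. openin T U \<Longrightarrow> f -` U \<inter> space M \<in> sets M"
  shows "f \<in> M \<rightarrow>\<^sub>M borel_of T"
  unfolding borel_of_def using assms by (intro measurable_measure_of) (auto dest: openin_subset)

text \<open>A limit is in the open set \<open>U\<close> exactly if the sequence eventually stays in one of the open
  sets \<open>inner r\<close> of the points at distance more than \<open>r\<close> from the complement.\<close>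

lemma (in Metric_space) measurable_borel_of_LIMSEQ:
  assumes f: "\<And>n. f n \<in> N \<rightarrow>\<^sub>M borel_of mtopology"
    and g: "g \<in> space N \<rightarrow> M"
    and lim: "\<And>\<omega>. \<omega> \<in> space N \<Longrightarrow> (\<lambda>n. d (f n \<omega>) (g \<omega>)) \<longlonglongrightarrow> 0"
  shows "g \<in> N \<rightarrow>\<^sub>M borel_of mtopology"
proof (rule measurable_borel_ofI)
  show "g \<in> space N \<rightarrow> topspace mtopology" using g by simp
  fix U assume U: "openin mtopology U"
  define inner where "inner r = {x\<in>M. \<exists>s>r. mball x s \<subseteq> U}" for r
  have fM: "f n \<omega> \<in> M" if "\<omega> \<in> space N" for n \<omega>
    using measurable_space[OF f that] by simp
  have op: "openin mtopology (inner r)" for r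
    unfolding openin_mtopology
  proof (intro conjI allI impI)
    show "inner r \<subseteq> M" by (auto simp: inner_def)
    fix x assume "x \<in> inner r"
    then obtain s where s: "x \<in> M" "r < s" "mball x s \<subseteq> U" by (auto simp: inner_def)
    have "mball x ((s - r)/2) \<subseteq> inner r"
    proof
      fix y assume y: "y \<in> mball x ((s - r)/2)"
      have "mball y ((s + r)/2) \<subseteq> mball x s"
      proof (rule mball_subset)
        show "d y x + (s + r) / 2 \<le> s" using y commute[of x y] by (simp add: field_simps)
      qed (fact s(1))
      then show "y \<in> inner r"
        using s y by (auto simp: inner_def intro!: exI[of _ "(s + r)/2"])
    qed
    then show "\<exists>q>0. mball x q \<subseteq> inner r" using s by (intro exI[of _ "(s - r)/2"]) auto
  qed
  have eq: "g -` U \<inter> space N = (\<Union>k. \<Union>n0. \<Inter>n\<in>{n0..}. f n -` inner (1 / real (Suc k)) \<inter> space N)"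
    (is "?L = ?R")
  proof (intro equalityI subsetI)
    fix \<omega> assume "\<omega> \<in> ?L"
    then have w: "\<omega> \<in> space N" "g \<omega> \<in> U" by auto
    then obtain r where r: "0 < r" "mball (g \<omega>) r \<subseteq> U" using U by (auto simp: openin_mtopology)
    obtain k where k: "1 / real (Suc k) < r/2" using nat_approx_posE[of "r/2"] r by auto
    have "\<forall>\<^sub>F n in sequentially. d (f n \<omega>) (g \<omega>) < r/2"
      using order_tendstoD(2)[OF lim[OF w(1)], of "r/2"] r by simp
    then obtain n0 where n0: "\<And>n. n0 \<le> n \<Longrightarrow> d (f n \<omega>) (g \<omega>) < r/2"
      by (auto simp: eventually_sequentially)
    have "f n \<omega> \<in> inner (1 / real (Suc k))" if "n0 \<le> n" for n
    proof -
      have "mball (f n \<omega>) (r/2) \<subseteq> mball (g \<omega>) r"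
        using n0[OF that] w(1) g by (intro mball_subset) auto
      then show ?thesis using k r fM[OF w(1)] by (auto simp: inner_def intro!: exI[of _ "r/2"])
    qed
    then show "\<omega> \<in> ?R" using w by auto
  next
    fix \<omega> assume "\<omega> \<in> ?R"
    then obtain k n0 where "\<And>n. n0 \<le> n \<Longrightarrow> f n \<omega> \<in> inner (1 / real (Suc k)) \<and> \<omega> \<in> space N"
      by auto
    then have kn: "\<And>n. n0 \<le> n \<Longrightarrow> f n \<omega> \<in> inner (1 / real (Suc k))" and w: "\<omega> \<in> space N" by auto
    have "\<forall>\<^sub>F n in sequentially. d (f n \<omega>) (g \<omega>) < 1 / real (Suc k) \<and> n0 \<le> n"
      using order_tendstoD(2)[OF lim[OF w], of "1 / real (Suc k)"] eventually_ge_at_top[of n0]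
      by (auto intro: eventually_conj)
    then obtain n where n: "d (f n \<omega>) (g \<omega>) < 1 / real (Suc k)" "n0 \<le> n"
      by (auto simp: eventually_sequentially)
    from kn[OF n(2)] obtain s where "1 / real (Suc k) < s" "mball (f n \<omega>) s \<subseteq> U"
      by (auto simp: inner_def)
    moreover have "g \<omega> \<in> M" using g w by blast
    ultimately have "g \<omega> \<in> U" using n fM[OF w, of n] by (auto intro!: subsetD[of "mball (f n \<omega>) s" U])
    then show "\<omega> \<in> ?L" using w by simp
  qed
  show "g -` U \<inter> space N \<in> sets N"
    unfolding eq by (intro sets.countable_UN sets.countable_INT' measurable_sets[OF f] sets_borel_of_openin op image_subsetI) auto
qed

text \<open>A step function on the grid \<open>k/n\<close> depends continuously on the sequence of its values, in
  the product topology because late values hardly affect the Skorohod distance.\<close>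

definition grid_step :: "nat \<Rightarrow> (nat \<Rightarrow> real) \<Rightarrow> real \<Rightarrow> real" where
  "grid_step n v = (\<lambda>t\<in>{0..}. v (nat \<lfloor>real n * t\<rfloor>))"

lemma grid_step_in_skorohod_space: "grid_step n v \<in> skorohod_space"
proof -
  have right: "\<forall>\<^sub>F s in at_right t. \<lfloor>real n * s\<rfloor> = \<lfloor>real n * t\<rfloor>" for t
  proof -
    have "((\<lambda>s. real n * s) \<longlongrightarrow> real n * t) (at_right t)" by (intro tendsto_intros)
    then have "\<forall>\<^sub>F s in at_right t. real n * s < real_of_int \<lfloor>real n * t\<rfloor> + 1"
      by (rule order_tendstoD) linarith
    with eventually_at_right_less[of t] show ?thesis
    proof eventually_elim
      case (elim s)
      have "real n * t \<le> real n * s" using elim by (intro mult_left_mono) auto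
      then show ?case using elim by linarith
    qed
  qed
  have left: "\<forall>\<^sub>F s in at_left t. \<lfloor>real n * s\<rfloor> = \<lceil>real n * t\<rceil> - 1" if n: "0 < n" for t
  proof -
    have "((\<lambda>s. real n * s) \<longlongrightarrow> real n * t) (at_left t)" by (intro tendsto_intros)
    then have "\<forall>\<^sub>F s in at_left t. real_of_int \<lceil>real n * t\<rceil> - 1 < real n * s"
      by (rule order_tendstoD) linarith
    moreover have "\<forall>\<^sub>F s in at_left t. s < t" by (auto simp: eventually_at_left_field intro: exI[of _ "t - 1"])
    ultimately show ?thesis
    proof eventually_elim
      case (elim s)
      have "real n * s < real n * t" using elim n by simp
      then show ?case using elim by linarith
    qed
  qed
  have "cadlag (grid_step n v)"
    unfolding cadlag_def
  proof (intro conjI allI impI)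
    fix t :: real assume t: "0 \<le> t"
    have "\<forall>\<^sub>F s in at_right t. grid_step n v t = grid_step n v s"
      using right[of t] eventually_at_right_less[of t]
      by eventually_elim (use t in \<open>auto simp: grid_step_def\<close>)
    then show "(grid_step n v \<longlongrightarrow> grid_step n v t) (at_right t)"
      by (rule Lim_transform_eventually[OF tendsto_const])
  next
    fix t :: real assume t: "0 < t"
    have pos: "\<forall>\<^sub>F s in at_left t. 0 < s" using t by (auto simp: eventually_at_left_field)
    show "\<exists>l. (grid_step n v \<longlongrightarrow> l) (at_left t)"
    proof (cases "n = 0")
      case True
      have "\<forall>\<^sub>F s in at_left t. v 0 = grid_step n v s"
        using pos by eventually_elim (auto simp: grid_step_def True)
      then show ?thesis by (blast intro: Lim_transform_eventually[OF tendsto_const])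
    next
      case False
      then have "\<forall>\<^sub>F s in at_left t. v (nat (\<lceil>real n * t\<rceil> - 1)) = grid_step n v s"
        using pos left[of t] by (auto simp: grid_step_def elim: eventually_elim2)
      then show ?thesis by (blast intro: Lim_transform_eventually[OF tendsto_const])
    qed
  qed
  then show ?thesis by (auto simp: skorohod_space_def grid_step_def)
qed

lemma open_vimage_grid_step:
  assumes "openin skorohod_topology U"
  shows "open (grid_step n -` U)"
  unfolding open_subopen[of "grid_step n -` U"]
proof (intro ballI)
  interpret Metric_space skorohod_space skorohod_dist by (rule skorohod_Metric_space)
  fix v assume "v \<in> grid_step n -` U"
  then obtain r where r: "0 < r" "mball (grid_step n v) r \<subseteq> U"
    using assms by (auto simp: skorohod_topology_def openin_mtopology)
  obtain T where T: "(1/2 :: real) ^ T < r/2" using real_arch_pow_inv[of "r/2" "1/2"] r by auto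
  define V where "V = (\<Inter>k\<in>{..n * T}. (\<lambda>w. w k) -` {v k - r/2 <..< v k + r/2})"
  have "open V" unfolding V_def
    by (intro open_INT ballI open_vimage continuous_on_product_coordinates) auto
  moreover have "v \<in> V" using r by (auto simp: V_def)
  moreover have "V \<subseteq> grid_step n -` U"
  proof
    fix w assume w: "w \<in> V"
    have "\<bar>grid_step n v t - grid_step n w t\<bar> \<le> r/2" if "0 \<le> t" "t < real T" for t
    proof -
      have "real n * t \<le> real (n * T)" using that by (simp add: mult_left_mono)
      then have "nat \<lfloor>real n * t\<rfloor> \<le> n * T" by linarith
      then have "w (nat \<lfloor>real n * t\<rfloor>) \<in> {v (nat \<lfloor>real n * t\<rfloor>) - r/2 <..< v (nat \<lfloor>real n * t\<rfloor>) + r/2}"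
        using w by (auto simp: V_def)
      then have "\<bar>v (nat \<lfloor>real n * t\<rfloor>) - w (nat \<lfloor>real n * t\<rfloor>)\<bar> \<le> r/2"
        unfolding greaterThanLessThan_iff by linarith
      then show ?thesis using that by (simp add: grid_step_def)
    qed
    then have "skorohod_dist (grid_step n v) (grid_step n w) \<le> r/2 + (1/2)^T"
      using r by (intro skorohod_dist_le_uniform) auto
    then have "grid_step n w \<in> mball (grid_step n v) r"
      using T grid_step_in_skorohod_space by simp
    then show "w \<in> grid_step n -` U" using r by auto
  qed
  ultimately show "\<exists>V. open V \<and> v \<in> V \<and> V \<subseteq> grid_step n -` U" by blast
qed

lemma restrict_cadlag_in_skorohod_space:
  fixes x :: "real \<Rightarrow> real"
  assumes x: "cadlag x" shows "(\<lambda>t\<in>{0..}. x t) \<in> skorohod_space"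
proof -
  have "((\<lambda>t\<in>{0..}. x t) \<longlongrightarrow> (\<lambda>t\<in>{0..}. x t) t) (at_right t)" if t: "0 \<le> t" for t
  proof -
    have "(x \<longlongrightarrow> x t) (at_right t)" using x t by (auto simp: cadlag_def)
    moreover have "\<forall>\<^sub>F s in at_right t. x s = (\<lambda>t\<in>{0..}. x t) s"
      using eventually_at_right_less[of t] by eventually_elim (use t in auto)
    ultimately show ?thesis using t by (auto intro: Lim_transform_eventually)
  qed
  moreover have "\<exists>l. ((\<lambda>t\<in>{0..}. x t) \<longlongrightarrow> l) (at_left t)" if t: "0 < t" for t
  proof -
    obtain l where "(x \<longlongrightarrow> l) (at_left t)" using x t by (auto simp: cadlag_def)
    moreover have "\<forall>\<^sub>F s in at_left t. 0 < s" using t by (auto simp: eventually_at_left_field)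
    then have "\<forall>\<^sub>F s in at_left t. x s = (\<lambda>t\<in>{0..}. x t) s"
      by eventually_elim auto
    ultimately show ?thesis by (blast intro: Lim_transform_eventually)
  qed
  ultimately show ?thesis by (auto simp: skorohod_space_def cadlag_def)
qed

text \<open>A cadlag process is the pointwise limit of its step approximations, each of which is a
  continuous function of countably many coordinates. Hence measurability of the coordinates
  suffices.\<close>

theorem cadlag_process_measurable:
  fixes X :: "real \<Rightarrow> 'a \<Rightarrow> real"
  assumes X: "\<And>t. 0 \<le> t \<Longrightarrow> X t \<in> borel_measurable M"
    and cad: "\<And>\<omega>. \<omega> \<in> space M \<Longrightarrow> cadlag (\<lambda>t. X t \<omega>)"
  shows "(\<lambda>\<omega>. \<lambda>t\<in>{0..}. X t \<omega>) \<in> M \<rightarrow>\<^sub>M borel_of skorohod_topology"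
proof -
  interpret Metric_space skorohod_space skorohod_dist by (rule skorohod_Metric_space)
  have top: "topspace skorohod_topology = skorohod_space" by (simp add: skorohod_topology_def)
  have cad': "(\<lambda>t\<in>{0..}. X t \<omega>) \<in> skorohod_space" if "\<omega> \<in> space M" for \<omega>
    by (rule restrict_cadlag_in_skorohod_space[OF cad[OF that]])
  define G where "G n \<omega> = grid_step n (\<lambda>k. X (real k / real n) \<omega>)" for n \<omega>
  show ?thesis
    unfolding skorohod_topology_def
  proof (rule measurable_borel_of_LIMSEQ[of G])
    fix n
    have "(\<lambda>\<omega> k. X (real k / real n) \<omega>) \<in> M \<rightarrow>\<^sub>M (\<Pi>\<^sub>M k\<in>UNIV. borel)"
      by (intro measurable_PiM_single') (auto intro!: X)
    then have meas: "(\<lambda>\<omega> k. X (real k / real n) \<omega>) \<in> borel_measurable M"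
      by (simp cong: measurable_cong_sets add: sets_PiM_equal_borel)
    show "G n \<in> M \<rightarrow>\<^sub>M borel_of mtopology"
    proof (rule measurable_borel_ofI)
      show "G n \<in> space M \<rightarrow> topspace mtopology" by (auto simp: G_def grid_step_in_skorohod_space)
      fix U assume "openin mtopology U"
      then have "open (grid_step n -` U)" by (intro open_vimage_grid_step) (simp add: skorohod_topology_def)
      then have "(\<lambda>\<omega> k. X (real k / real n) \<omega>) -` (grid_step n -` U) \<inter> space M \<in> sets M"
        by (intro measurable_sets[OF meas]) auto
      moreover have "(\<lambda>\<omega> k. X (real k / real n) \<omega>) -` (grid_step n -` U) \<inter> space M = G n -` U \<inter> space M"
        by (auto simp: G_def)
      ultimately show "G n -` U \<inter> space M \<in> sets M" by simp
    qed
  next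
    show "(\<lambda>\<omega>. \<lambda>t\<in>{0..}. X t \<omega>) \<in> space M \<rightarrow> skorohod_space" using cad' by auto
    fix \<omega> assume w: "\<omega> \<in> space M"
    show "(\<lambda>n. skorohod_dist (G n \<omega>) (\<lambda>t\<in>{0..}. X t \<omega>)) \<longlonglongrightarrow> 0"
    proof (rule skorohod_dist_grid_step_tendsto)
      show "cadlag (\<lambda>t\<in>{0..}. X t \<omega>)" using cad'[OF w] by (simp add: skorohod_space_def)
      show "G n \<omega> t = (\<lambda>t\<in>{0..}. X t \<omega>) (grid_floor n t)" if "0 \<le> t" for n t
        using that by (auto simp: G_def grid_step_def grid_floor_def)
    qed
  qed
qed

section \<open>Laws of paths\<close>

text \<open>The law of a process on the product \<open>\<sigma>\<close>-algebra, that is, the collection of its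
  finite-dimensional distributions.\<close>

definition path_law :: "'a measure \<Rightarrow> (real \<Rightarrow> 'a \<Rightarrow> 'b::topological_space) \<Rightarrow> (real \<Rightarrow> 'b) measure" where
  "path_law M X = distr M (\<Pi>\<^sub>M t\<in>{0..}. borel) (\<lambda>\<omega>. \<lambda>t\<in>{0..}. X t \<omega>)"

lemma measurable_path:
  assumes "\<And>t. 0 \<le> t \<Longrightarrow> X t \<in> borel_measurable M"
  shows "(\<lambda>\<omega>. \<lambda>t\<in>{0::real..}. X t \<omega>) \<in> M \<rightarrow>\<^sub>M (\<Pi>\<^sub>M t\<in>{0..}. borel)"
  using assms by (intro measurable_restrict) auto

lemma distr_functional_of_path:
  assumes X: "\<And>t. 0 \<le> t \<Longrightarrow> X t \<in> borel_measurable M"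
    and Y: "\<And>t. 0 \<le> t \<Longrightarrow> Y t \<in> borel_measurable N"
    and law: "path_law M X = path_law N Y"
    and h: "h \<in> (\<Pi>\<^sub>M t\<in>{0..}. borel) \<rightarrow>\<^sub>M S"
  shows "distr M S (\<lambda>\<omega>. h (\<lambda>t\<in>{0..}. X t \<omega>)) = distr N S (\<lambda>\<omega>. h (\<lambda>t\<in>{0..}. Y t \<omega>))"
proof -
  have "distr M S (\<lambda>\<omega>. h (\<lambda>t\<in>{0..}. X t \<omega>)) = distr (path_law M X) S h"
    unfolding path_law_def by (subst distr_distr[OF h measurable_path[OF X]]) (auto simp: comp_def)
  also have "\<dots> = distr N S (\<lambda>\<omega>. h (\<lambda>t\<in>{0..}. Y t \<omega>))"
    by (simp only: law, unfold path_law_def, subst distr_distr[OF h measurable_path[OF Y]]) (auto simp: comp_def)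
  finally show ?thesis .
qed

lemma path_law_cong_AE:
  assumes X: "\<And>t. 0 \<le> t \<Longrightarrow> X t \<in> borel_measurable M"
    and Y: "\<And>t. 0 \<le> t \<Longrightarrow> Y t \<in> borel_measurable M"
    and eq: "AE \<omega> in M. \<forall>t\<ge>0. X t \<omega> = Y t \<omega>"
  shows "path_law M X = path_law M Y"
  unfolding path_law_def
proof (rule distr_cong_AE)
  show "AE \<omega> in M. (\<lambda>t\<in>{0..}. X t \<omega>) = (\<lambda>t\<in>{0..}. Y t \<omega>)"
    using eq by eventually_elim (auto simp: fun_eq_iff)
qed (auto intro!: measurable_path X Y)

lemma nonneg_of_ascending:
  fixes t :: "nat \<Rightarrow> real"
  assumes "0 \<le> t 0" "\<And>i. i < n \<Longrightarrow> t i \<le> t (Suc i)" "i \<le> n"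
  shows "0 \<le> t i"
  using assms(3)
proof (induction i)
  case (Suc i)
  then show ?case using assms(2)[of i] by auto
qed (use assms in auto)

lemma (in levy_process) joint_increment_law:
  fixes t :: "nat \<Rightarrow> real"
  assumes t: "0 \<le> t 0" "\<And>i. i < n \<Longrightarrow> t i \<le> t (Suc i)" and n: "n \<noteq> 0"
  shows "distr M (\<Pi>\<^sub>M i\<in>{..<n}. borel) (\<lambda>\<omega>. \<lambda>i\<in>{..<n}. X (t (Suc i)) \<omega> - X (t i) \<omega>)
      = (\<Pi>\<^sub>M i\<in>{..<n}. distr M borel (\<lambda>\<omega>. X (t (Suc i)) \<omega> - X (t i) \<omega>))"
proof (rule indep_vars_iff_distr_eq_PiM'[THEN iffD1])
  show "indep_vars (\<lambda>_. borel) (\<lambda>i \<omega>. X (t (Suc i)) \<omega> - X (t i) \<omega>) {..<n}"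
    using t by (rule independent_increments)
  show "(\<lambda>\<omega>. X (t (Suc i)) \<omega> - X (t i) \<omega>) \<in> borel_measurable M" if "i \<in> {..<n}" for i
    using that by (intro borel_measurable_diff random_variable_at nonneg_of_ascending[OF t]) auto
qed (use n in auto)

lemma measurable_increment_PiM:
  fixes t :: real
  assumes "0 \<le> s" "0 \<le> t"
  shows "(\<lambda>w. w t - w s :: 'b::euclidean_space) \<in> (\<Pi>\<^sub>M t\<in>{0..}. borel) \<rightarrow>\<^sub>M borel"
  using assms by (intro borel_measurable_diff measurable_component_singleton) auto

text \<open>Apart from the regularity of the paths, being a stable process is a property of the
  finite-dimensional distributions.\<close>

lemma isotropic_stable_process_of_path_law:
  fixes X :: "real \<Rightarrow> 'a \<Rightarrow> 'b::euclidean_space" and Y :: "real \<Rightarrow> 'c \<Rightarrow> 'b"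
  assumes "isotropic_stable_process M \<alpha> \<kappa> x X" and "prob_space N"
    and Y: "\<And>t. 0 \<le> t \<Longrightarrow> Y t \<in> borel_measurable N"
    and cad: "AE \<omega> in N. cadlag (\<lambda>t. Y t \<omega>)"
    and law: "path_law N Y = path_law M X"
  shows "isotropic_stable_process N \<alpha> \<kappa> x Y"
proof -
  interpret M: isotropic_stable_process M \<alpha> \<kappa> x X by fact
  interpret N: prob_space N by fact
  note X = M.random_variable_at
  have trans: "distr N S (\<lambda>\<omega>. h (\<lambda>t\<in>{0..}. Y t \<omega>)) = distr M S (\<lambda>\<omega>. h (\<lambda>t\<in>{0..}. X t \<omega>))"
    if "h \<in> (\<Pi>\<^sub>M t\<in>{0..}. borel) \<rightarrow>\<^sub>M S" for S :: "'d measure" and h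
    using Y X law that by (rule distr_functional_of_path)
  have inc: "distr N borel (\<lambda>\<omega>. Y t \<omega> - Y s \<omega>) = distr M borel (\<lambda>\<omega>. X t \<omega> - X s \<omega>)"
    if "0 \<le> s" "0 \<le> t" for s t
    using trans[OF measurable_increment_PiM[OF that]] that by simp
  show ?thesis
  proof (unfold_locales)
    show "Y t \<in> borel_measurable N" if "0 \<le> t" for t using Y[OF that] .
    show "AE \<omega> in N. cadlag (\<lambda>t. Y t \<omega>)" by (fact cad)
  next
    fix n :: nat and t :: "nat \<Rightarrow> real"
    assume t: "0 \<le> t 0" "\<And>i. i < n \<Longrightarrow> t i \<le> t (Suc i)"
    have t0: "0 \<le> t i" if "i \<le> n" for i using nonneg_of_ascending[OF t that] .
    show "N.indep_vars (\<lambda>_. borel) (\<lambda>i \<omega>. Y (t (Suc i)) \<omega> - Y (t i) \<omega>) {..<n}"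
    proof (cases "n = 0")
      case True
      then show ?thesis by (simp add: N.indep_vars_def N.indep_sets_def)
    next
      case False
      define h where "h w = (\<lambda>i\<in>{..<n}. w (t (Suc i)) - w (t i) :: 'b)" for w
      have h: "h \<in> (\<Pi>\<^sub>M t\<in>{0..}. borel) \<rightarrow>\<^sub>M (\<Pi>\<^sub>M i\<in>{..<n}. borel)"
        unfolding h_def by (intro measurable_restrict measurable_increment_PiM t0) auto
      have "distr N (\<Pi>\<^sub>M i\<in>{..<n}. borel) (\<lambda>\<omega>. \<lambda>i\<in>{..<n}. Y (t (Suc i)) \<omega> - Y (t i) \<omega>)
          = distr N (\<Pi>\<^sub>M i\<in>{..<n}. borel) (\<lambda>\<omega>. h (\<lambda>t\<in>{0..}. Y t \<omega>))"
        using t0 by (intro distr_cong) (auto simp: h_def fun_eq_iff)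
      also have "\<dots> = distr M (\<Pi>\<^sub>M i\<in>{..<n}. borel) (\<lambda>\<omega>. h (\<lambda>t\<in>{0..}. X t \<omega>))"
        by (rule trans[OF h])
      also have "\<dots> = distr M (\<Pi>\<^sub>M i\<in>{..<n}. borel) (\<lambda>\<omega>. \<lambda>i\<in>{..<n}. X (t (Suc i)) \<omega> - X (t i) \<omega>)"
        using t0 by (intro distr_cong) (auto simp: h_def fun_eq_iff)
      also have "\<dots> = (\<Pi>\<^sub>M i\<in>{..<n}. distr M borel (\<lambda>\<omega>. X (t (Suc i)) \<omega> - X (t i) \<omega>))"
        using t False by (rule M.joint_increment_law)
      also have "\<dots> = (\<Pi>\<^sub>M i\<in>{..<n}. distr N borel (\<lambda>\<omega>. Y (t (Suc i)) \<omega> - Y (t i) \<omega>))"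
        using t0 by (intro PiM_cong) (auto simp: inc)
      finally show ?thesis using False t0
        by (subst N.indep_vars_iff_distr_eq_PiM') (auto intro!: Y borel_measurable_diff)
    qed
  next
    fix s t :: real assume "0 \<le> s" "0 \<le> t"
    then show "distr N borel (\<lambda>\<omega>. Y (s + t) \<omega> - Y s \<omega>) = distr N borel (\<lambda>\<omega>. Y t \<omega> - Y 0 \<omega>)"
      using M.stationary_increments[of s t] by (simp add: inc)
  next
    have "distr N borel (Y 0) = distr M borel (X 0)"
      using trans[of "\<lambda>w. w 0" borel] by (simp add: measurable_component_singleton)
    moreover have "AE y in distr M borel (X 0). y = x"
      using M.start by (subst AE_distr_iff) (auto intro: X)
    ultimately have "AE y in distr N borel (Y 0). y = x" by (simp only:)
    then show "AE \<omega> in N. Y 0 \<omega> = x"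
      by (subst (asm) AE_distr_iff) (auto intro: Y)
  next
    fix t :: real and u :: 'b assume t: "0 \<le> t"
    have "(CLINT \<omega>|N. iexp (u \<bullet> (Y t \<omega> - Y 0 \<omega>))) = (CLINT y|distr N borel (\<lambda>\<omega>. Y t \<omega> - Y 0 \<omega>). iexp (u \<bullet> y))"
      using t by (subst integral_distr) (auto intro!: Y borel_measurable_diff borel_measurable_continuous_onI continuous_intros)
    also have "\<dots> = (CLINT \<omega>|M. iexp (u \<bullet> (X t \<omega> - X 0 \<omega>)))"
      unfolding inc[OF order_refl t] using t
      by (subst integral_distr) (auto intro!: X borel_measurable_diff borel_measurable_continuous_onI continuous_intros)
    finally show "(CLINT \<omega>|N. iexp (u \<bullet> (Y t \<omega> - Y 0 \<omega>))) = of_real (exp (- t * \<kappa> * norm u powr \<alpha>))"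
      using M.characteristic_function[OF t] by simp
  qed
qed

section \<open>Uniqueness in law of real stable processes\<close>

text \<open>The characteristic function determines the law of an increment, independence the joint law of
  successive increments, and the values at finitely many times are partial sums of such
  increments.\<close>

context
  fixes \<alpha> \<kappa> x :: real and M :: "'a measure" and X :: "real \<Rightarrow> 'a \<Rightarrow> real"
    and N :: "'c measure" and Y :: "real \<Rightarrow> 'c \<Rightarrow> real"
  assumes MX: "isotropic_stable_process M \<alpha> \<kappa> x X" and NY: "isotropic_stable_process N \<alpha> \<kappa> x Y"
begin

interpretation M: isotropic_stable_process M \<alpha> \<kappa> x X by (rule MX)
interpretation N: isotropic_stable_process N \<alpha> \<kappa> x Y by (rule NY)

lemma stable_increment_law_unique:
  assumes "0 \<le> s" "s \<le> t"
  shows "distr M borel (\<lambda>\<omega>. X t \<omega> - X s \<omega>) = distr N borel (\<lambda>\<omega>. Y t \<omega> - Y s \<omega>)"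
proof -
  have r: "0 \<le> t - s" using assms by simp
  have X: "(\<lambda>\<omega>. X (t - s) \<omega> - X 0 \<omega>) \<in> borel_measurable M"
    and Y: "(\<lambda>\<omega>. Y (t - s) \<omega> - Y 0 \<omega>) \<in> borel_measurable N"
    using r by (auto intro!: borel_measurable_diff M.random_variable_at N.random_variable_at)
  have iexp [measurable]: "(\<lambda>y. iexp (u * y)) \<in> borel_measurable borel" for u
    by (intro borel_measurable_continuous_onI continuous_intros)
  have "distr M borel (\<lambda>\<omega>. X (t - s) \<omega> - X 0 \<omega>) = distr N borel (\<lambda>\<omega>. Y (t - s) \<omega> - Y 0 \<omega>)"
  proof (rule Levy_uniqueness)
    show "real_distribution (distr M borel (\<lambda>\<omega>. X (t - s) \<omega> - X 0 \<omega>))"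
      using M.prob_space_distr[OF X] by (simp add: real_distribution_def real_distribution_axioms_def)
    show "real_distribution (distr N borel (\<lambda>\<omega>. Y (t - s) \<omega> - Y 0 \<omega>))"
      using N.prob_space_distr[OF Y] by (simp add: real_distribution_def real_distribution_axioms_def)
    show "char (distr M borel (\<lambda>\<omega>. X (t - s) \<omega> - X 0 \<omega>)) = char (distr N borel (\<lambda>\<omega>. Y (t - s) \<omega> - Y 0 \<omega>))"
    proof
      fix u :: real
      show "char (distr M borel (\<lambda>\<omega>. X (t - s) \<omega> - X 0 \<omega>)) u = char (distr N borel (\<lambda>\<omega>. Y (t - s) \<omega> - Y 0 \<omega>)) u"
        unfolding char_def integral_distr[OF X iexp] integral_distr[OF Y iexp]
        using M.characteristic_function[OF r, of u] N.characteristic_function[OF r, of u]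
        unfolding inner_real_def by (rule trans[OF _ sym])
    qed
  qed
  then show ?thesis
    using M.stationary_increments[OF assms(1) r] N.stationary_increments[OF assms(1) r] by simp
qed

lemma stable_joint_increment_law_unique:
  fixes t :: "nat \<Rightarrow> real"
  assumes t: "0 \<le> t 0" "\<And>i. i < n \<Longrightarrow> t i \<le> t (Suc i)"
  shows "distr M (\<Pi>\<^sub>M i\<in>{..<n}. borel) (\<lambda>\<omega>. \<lambda>i\<in>{..<n}. X (t (Suc i)) \<omega> - X (t i) \<omega>) =
         distr N (\<Pi>\<^sub>M i\<in>{..<n}. borel) (\<lambda>\<omega>. \<lambda>i\<in>{..<n}. Y (t (Suc i)) \<omega> - Y (t i) \<omega>)"
proof (cases "n = 0")
  case True
  have "emeasure M (space M) = emeasure N (space N)"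
    by (simp add: M.emeasure_space_1 N.emeasure_space_1)
  moreover have "A = {} \<or> A = {\<lambda>_. undefined}" if "A \<subseteq> {\<lambda>_. undefined :: real}" for A :: "(nat \<Rightarrow> real) set"
    using that by blast
  ultimately show ?thesis
    by (intro measure_eqI) (auto simp: True PiM_empty restrict_def emeasure_distr)
next
  case False
  have t0: "0 \<le> t i" if "i \<le> n" for i using nonneg_of_ascending[OF t that] .
  have "distr M (\<Pi>\<^sub>M i\<in>{..<n}. borel) (\<lambda>\<omega>. \<lambda>i\<in>{..<n}. X (t (Suc i)) \<omega> - X (t i) \<omega>)
      = (\<Pi>\<^sub>M i\<in>{..<n}. distr M borel (\<lambda>\<omega>. X (t (Suc i)) \<omega> - X (t i) \<omega>))"
    using t False by (rule M.joint_increment_law)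
  also have "\<dots> = (\<Pi>\<^sub>M i\<in>{..<n}. distr N borel (\<lambda>\<omega>. Y (t (Suc i)) \<omega> - Y (t i) \<omega>))"
    using t0 t by (intro PiM_cong stable_increment_law_unique) auto
  also have "\<dots> = distr N (\<Pi>\<^sub>M i\<in>{..<n}. borel) (\<lambda>\<omega>. \<lambda>i\<in>{..<n}. Y (t (Suc i)) \<omega> - Y (t i) \<omega>)"
    using t False by (rule N.joint_increment_law[symmetric])
  finally show ?thesis .
qed

lemma stable_finite_dimensional_law_unique:
  assumes J: "finite J" "J \<subseteq> {0..}"
  shows "distr M (\<Pi>\<^sub>M s\<in>J. borel) (\<lambda>\<omega>. \<lambda>s\<in>J. X s \<omega>) = distr N (\<Pi>\<^sub>M s\<in>J. borel) (\<lambda>\<omega>. \<lambda>s\<in>J. Y s \<omega>)"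
proof -
  define n where "n = card J"
  define t where "t i = (0 # sorted_list_of_set J) ! i" for i
  have sorted: "sorted (0 # sorted_list_of_set J)" using J by auto
  have len: "length (0 # sorted_list_of_set J) = Suc n" using J by (simp add: n_def)
  have t: "0 \<le> t 0" "\<And>i. i < n \<Longrightarrow> t i \<le> t (Suc i)"
    using sorted_nth_mono[OF sorted, of i "Suc i" for i] len by (simp_all add: t_def)
  have t0: "0 \<le> t i" if "i \<le> n" for i using nonneg_of_ascending[OF t that] .
  have "\<exists>k\<le>n. t k = s" if "s \<in> J" for s
  proof -
    have "s \<in> set (0 # sorted_list_of_set J)" using that J by simp
    then obtain k where "k < Suc n" "(0 # sorted_list_of_set J) ! k = s"
      unfolding in_set_conv_nth len by blast
    then show ?thesis by (auto simp: t_def intro!: exI[of _ k])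
  qed
  then obtain k where k: "\<And>s. s \<in> J \<Longrightarrow> k s \<le> n \<and> t (k s) = s" by metis
  define G :: "(nat \<Rightarrow> real) \<Rightarrow> real \<Rightarrow> real" where "G v = (\<lambda>s\<in>J. x + (\<Sum>i<k s. v i))" for v
  have G: "G \<in> (\<Pi>\<^sub>M i\<in>{..<n}. borel) \<rightarrow>\<^sub>M (\<Pi>\<^sub>M s\<in>J. borel)"
    unfolding G_def
    by (intro measurable_restrict borel_measurable_add borel_measurable_sum borel_measurable_const
        measurable_component_singleton) (use k in \<open>auto intro: less_le_trans\<close>)
  have G_inc: "G (\<lambda>i\<in>{..<n}. W (t (Suc i)) - W (t i)) = (\<lambda>s\<in>J. W s)" if "W 0 = x" for W
  proof
    fix s
    show "G (\<lambda>i\<in>{..<n}. W (t (Suc i)) - W (t i)) s = (\<lambda>s\<in>J. W s) s"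
    proof (cases "s \<in> J")
      case True
      have "(\<Sum>i<k s. (\<lambda>i\<in>{..<n}. W (t (Suc i)) - W (t i)) i) = (\<Sum>i<k s. W (t (Suc i)) - W (t i))"
        using k[OF True] by (intro sum.cong) auto
      also have "\<dots> = W (t (k s)) - W (t 0)" by (rule sum_lessThan_telescope)
      also have "\<dots> = W s - x" using k[OF True] that by (simp add: t_def)
      finally show ?thesis using True by (simp add: G_def)
    qed (simp add: G_def)
  qed
  have inc_meas: "(\<lambda>\<omega>. \<lambda>i\<in>{..<n}. W (t (Suc i)) \<omega> - W (t i) \<omega>) \<in> P \<rightarrow>\<^sub>M (\<Pi>\<^sub>M i\<in>{..<n}. borel)"
    if "\<And>t. 0 \<le> t \<Longrightarrow> W t \<in> borel_measurable P" for P :: "'d measure" and W :: "real \<Rightarrow> 'd \<Rightarrow> real"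
    using that t0 by (intro measurable_restrict borel_measurable_diff) auto
  have reduce: "distr P (\<Pi>\<^sub>M s\<in>J. borel) (\<lambda>\<omega>. \<lambda>s\<in>J. W s \<omega>) =
      distr (distr P (\<Pi>\<^sub>M i\<in>{..<n}. borel) (\<lambda>\<omega>. \<lambda>i\<in>{..<n}. W (t (Suc i)) \<omega> - W (t i) \<omega>)) (\<Pi>\<^sub>M s\<in>J. borel) G"
    if W: "\<And>t. 0 \<le> t \<Longrightarrow> W t \<in> borel_measurable P" and start: "AE \<omega> in P. W 0 \<omega> = x"
    for P :: "'d measure" and W :: "real \<Rightarrow> 'd \<Rightarrow> real"
  proof (subst distr_distr[OF G], rule inc_meas[OF W], assumption, rule distr_cong_AE)
    show "AE \<omega> in P. (\<lambda>s\<in>J. W s \<omega>) = (G \<circ> (\<lambda>\<omega>. \<lambda>i\<in>{..<n}. W (t (Suc i)) \<omega> - W (t i) \<omega>)) \<omega>"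
      using start by eventually_elim (use G_inc[of "\<lambda>t. W t \<omega>" for \<omega>] in simp)
    show "(\<lambda>\<omega>. \<lambda>s\<in>J. W s \<omega>) \<in> P \<rightarrow>\<^sub>M (\<Pi>\<^sub>M s\<in>J. borel)"
      using W J by (intro measurable_restrict) auto
    show "G \<circ> (\<lambda>\<omega>. \<lambda>i\<in>{..<n}. W (t (Suc i)) \<omega> - W (t i) \<omega>) \<in> P \<rightarrow>\<^sub>M (\<Pi>\<^sub>M s\<in>J. borel)"
      using W by (intro measurable_comp[OF inc_meas G])
  qed auto
  show ?thesis
    using stable_joint_increment_law_unique[OF t] reduce[of X M] reduce[of Y N]
      M.random_variable_at M.start N.random_variable_at N.start by simp
qed

theorem stable_path_law_unique: "path_law M X = path_law N Y"
proof (rule measure_eqI_PiM_infinite)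
  show "sets (path_law M X) = sets (\<Pi>\<^sub>M t\<in>{0..}. borel)" "sets (path_law N Y) = sets (\<Pi>\<^sub>M t\<in>{0..}. borel)"
    by (simp_all add: path_law_def)
  show "finite_measure (path_law M X)"
    unfolding path_law_def
    by (intro finite_measureI) (simp add: emeasure_distr measurable_path M.random_variable_at M.emeasure_space_1)
next
  fix A :: "real \<Rightarrow> real set" and J :: "real set"
  assume J: "finite J" "J \<subseteq> {0..}" and A: "\<And>i. i \<in> J \<Longrightarrow> A i \<in> sets borel"
  have box: "Pi\<^sub>E J A \<in> sets (\<Pi>\<^sub>M s\<in>J. borel)" using A J by (intro sets_PiM_I_finite) auto
  have emb: "emeasure (path_law P W) (prod_emb {0..} (\<lambda>_. borel) J (Pi\<^sub>E J A)) =
      emeasure (distr P (\<Pi>\<^sub>M s\<in>J. borel) (\<lambda>\<omega>. \<lambda>s\<in>J. W s \<omega>)) (Pi\<^sub>E J A)"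
    if W: "\<And>t. 0 \<le> t \<Longrightarrow> W t \<in> borel_measurable P" for P :: "'d measure" and W :: "real \<Rightarrow> 'd \<Rightarrow> real"
  proof -
    have 1: "prod_emb {0..} (\<lambda>_. borel) J (Pi\<^sub>E J A) \<in> sets (\<Pi>\<^sub>M t\<in>{0..}. borel)"
      using J A by (intro sets_PiM_I) auto
    have 2: "(\<lambda>\<omega>. \<lambda>s\<in>J. W s \<omega>) \<in> P \<rightarrow>\<^sub>M (\<Pi>\<^sub>M s\<in>J. borel)"
      using W J by (intro measurable_restrict) auto
    have "(\<lambda>\<omega>. \<lambda>t\<in>{0..}. W t \<omega>) -` prod_emb {0..} (\<lambda>_. borel) J (Pi\<^sub>E J A) \<inter> space P =
        (\<lambda>\<omega>. \<lambda>s\<in>J. W s \<omega>) -` Pi\<^sub>E J A \<inter> space P"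
      using subsetD[OF J(2)] by (auto simp: prod_emb_iff PiE_iff)
    moreover have "(\<lambda>\<omega>. \<lambda>t\<in>{0..}. W t \<omega>) \<in> P \<rightarrow>\<^sub>M (\<Pi>\<^sub>M t\<in>{0..}. borel)"
      using W by (rule measurable_path)
    ultimately show ?thesis
      unfolding path_law_def by (simp only: emeasure_distr 1 2 box)
  qed
  show "emeasure (path_law M X) (prod_emb {0..} (\<lambda>_. borel) J (Pi\<^sub>E J A)) =
        emeasure (path_law N Y) (prod_emb {0..} (\<lambda>_. borel) J (Pi\<^sub>E J A))"
    by (subst emb, erule M.random_variable_at, subst emb, erule N.random_variable_at)
      (simp only: stable_finite_dimensional_law_unique[OF J])
qed

end

section \<open>Self-similarity of projections\<close>

lemma cadlag_rescale:
  fixes x :: "real \<Rightarrow> 'b::t2_space" and f :: "'b \<Rightarrow> 'c::topological_space"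
  assumes x: "cadlag x" and c: "0 < c" and f: "continuous_on UNIV f"
  shows "cadlag (\<lambda>t. f (x (c * t)))"
proof -
  have cont: "isCont f y" for y using f by (simp add: continuous_on_eq_continuous_at)
  have right: "filterlim (\<lambda>s. c * s) (at_right (c * t)) (at_right t)" for t
    unfolding filterlim_at
    by (intro conjI tendsto_intros eventually_mono[OF eventually_at_right_less[of t]]) (use c in auto)
  have left: "filterlim (\<lambda>s. c * s) (at_left (c * t)) (at_left t)" for t
    unfolding filterlim_at
    by (intro conjI tendsto_intros eventually_at_leftI[of "t - 1"]) (use c in auto)
  show ?thesis
    unfolding cadlag_def
  proof (intro conjI allI impI)
    fix t :: real assume "0 \<le> t"
    then have "(x \<longlongrightarrow> x (c * t)) (at_right (c * t))" using x c by (auto simp: cadlag_def)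
    from isCont_tendsto_compose[OF cont filterlim_compose[OF this right]]
    show "((\<lambda>t. f (x (c * t))) \<longlongrightarrow> f (x (c * t))) (at_right t)" .
  next
    fix t :: real assume "0 < t"
    then have "0 < c * t" using c by simp
    then obtain l where "(x \<longlongrightarrow> l) (at_left (c * t))" using x unfolding cadlag_def by blast
    from isCont_tendsto_compose[OF cont filterlim_compose[OF this left]]
    show "\<exists>l. ((\<lambda>t. f (x (c * t))) \<longlongrightarrow> l) (at_left t)" by blast
  qed
qed

text \<open>Rescaling time by \<open>c\<close> and space by \<open>c\<^sup>-\<^sup>1\<^sup>/\<^sup>\<alpha>\<close> leaves the characteristic functions unchanged.
  One-dimensional projections are taken because for these Levy's uniqueness theorem turns this into
  equality of laws.\<close>

lemma stable_projection_rescale: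
  fixes Z :: "real \<Rightarrow> 'a \<Rightarrow> 'b::euclidean_space"
  assumes Z: "isotropic_stable_process M \<alpha> \<kappa> z Z" and \<alpha>: "0 < \<alpha>" and c: "0 < c" and v: "norm v = 1"
  shows "isotropic_stable_process M \<alpha> \<kappa> 0 (\<lambda>t \<omega>. c powr (- 1 / \<alpha>) * (v \<bullet> (Z (c * t) \<omega> - z)))"
proof -
  interpret Z: isotropic_stable_process M \<alpha> \<kappa> z Z by fact
  define b where "b = c powr (- 1 / \<alpha>)"
  define L where "L y = b * (v \<bullet> y)" for y
  have L: "L \<in> borel_measurable borel" unfolding L_def by (intro borel_measurable_continuous_onI continuous_intros)
  have L_diff: "b * (v \<bullet> (y - z)) - b * (v \<bullet> (y' - z)) = L (y - y')" for y y'
    by (simp add: L_def algebra_simps)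
  have Zm: "Z (c * t) \<in> borel_measurable M" if "0 \<le> t" for t
    using that c by (intro Z.random_variable_at) auto
  show ?thesis
    unfolding b_def[symmetric]
  proof (unfold_locales, unfold L_diff)
    show "(\<lambda>\<omega>. b * (v \<bullet> (Z (c * t) \<omega> - z))) \<in> borel_measurable M" if "0 \<le> t" for t
      using Zm[OF that] by measurable
  next
    fix n :: nat and t :: "nat \<Rightarrow> real"
    assume t: "0 \<le> t 0" "\<And>i. i < n \<Longrightarrow> t i \<le> t (Suc i)"
    have "Z.indep_vars (\<lambda>_. borel) (\<lambda>i \<omega>. Z (c * t (Suc i)) \<omega> - Z (c * t i) \<omega>) {..<n}"
      using t c by (intro Z.independent_increments[of "\<lambda>i. c * t i"]) auto
    then show "Z.indep_vars (\<lambda>_. borel) (\<lambda>i \<omega>. L (Z (c * t (Suc i)) \<omega> - Z (c * t i) \<omega>)) {..<n}"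
      by (rule Z.indep_vars_compose2) (rule L)
  next
    fix s t :: real assume st: "0 \<le> s" "0 \<le> t"
    have "distr M borel (\<lambda>\<omega>. L (Z (c * (s + t)) \<omega> - Z (c * s) \<omega>)) =
        distr (distr M borel (\<lambda>\<omega>. Z (c * s + c * t) \<omega> - Z (c * s) \<omega>)) borel L"
      using st by (subst distr_distr[OF L]) (auto intro!: borel_measurable_diff Zm simp: comp_def simp flip: distrib_left)
    also have "\<dots> = distr (distr M borel (\<lambda>\<omega>. Z (c * t) \<omega> - Z 0 \<omega>)) borel L"
      using st c by (subst Z.stationary_increments) auto
    also have "\<dots> = distr M borel (\<lambda>\<omega>. L (Z (c * t) \<omega> - Z (c * 0) \<omega>))"
      using st Zm[of 0] by (subst distr_distr[OF L]) (auto intro!: borel_measurable_diff Zm simp: comp_def)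
    finally show "distr M borel (\<lambda>\<omega>. L (Z (c * (s + t)) \<omega> - Z (c * s) \<omega>)) =
        distr M borel (\<lambda>\<omega>. L (Z (c * t) \<omega> - Z (c * 0) \<omega>))" .
  next
    show "AE \<omega> in M. cadlag (\<lambda>t. b * (v \<bullet> (Z (c * t) \<omega> - z)))"
      using Z.cadlag_paths
      by eventually_elim (rule cadlag_rescale[where f = "\<lambda>y. b * (v \<bullet> (y - z))"], auto intro!: continuous_intros c)
    show "AE \<omega> in M. b * (v \<bullet> (Z (c * 0) \<omega> - z)) = 0"
      using Z.start by eventually_elim simp
  next
    fix t u :: real assume t: "0 \<le> t"
    have "norm ((u * b) *\<^sub>R v) powr \<alpha> = norm u powr \<alpha> * b powr \<alpha>"
      by (simp add: v abs_mult b_def powr_mult)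
    also have "b powr \<alpha> = c powr (- 1)" using \<alpha> by (simp only: b_def powr_powr) simp
    also have "\<dots> = 1 / c" using c by (simp add: powr_minus_divide)
    finally have *: "c * norm ((u * b) *\<^sub>R v) powr \<alpha> = norm u powr \<alpha>" using c by simp
    have "(CLINT \<omega>|M. iexp (u \<bullet> L (Z (c * t) \<omega> - Z (c * 0) \<omega>))) =
        (CLINT \<omega>|M. iexp (((u * b) *\<^sub>R v) \<bullet> (Z (c * t) \<omega> - Z 0 \<omega>)))"
      by (simp add: L_def mult.assoc)
    also have "\<dots> = of_real (exp (- (c * t) * \<kappa> * norm ((u * b) *\<^sub>R v) powr \<alpha>))"
      using t c by (intro Z.characteristic_function) auto
    also have "- (c * t) * \<kappa> * norm ((u * b) *\<^sub>R v) powr \<alpha> = - t * \<kappa> * norm u powr \<alpha>"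
      unfolding *[symmetric] by (simp only: mult_ac mult_minus_left mult_minus_right)
    finally show "(CLINT \<omega>|M. iexp (u \<bullet> L (Z (c * t) \<omega> - Z (c * 0) \<omega>))) =
        of_real (exp (- t * \<kappa> * norm u powr \<alpha>))" .
  qed
qed

section \<open>Laws on the Skorohod space\<close>

text \<open>The cadlag paths do not form a measurable set of the product \<open>\<sigma>\<close>-algebra, which
  sees only countably many times; the trace of this \<open>\<sigma>\<close>-algebra on them is used instead.\<close>

definition cadlag_path_algebra :: "(real \<Rightarrow> real) measure" where
  "cadlag_path_algebra = restrict_space (\<Pi>\<^sub>M t\<in>{0..}. borel) skorohod_space"

lemma cadlag_path_algebra_coordinate:
  "0 \<le> t \<Longrightarrow> (\<lambda>w. w t) \<in> borel_measurable cadlag_path_algebra"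
  unfolding cadlag_path_algebra_def
  by (intro measurable_restrict_space1 measurable_component_singleton) auto

lemma cadlag_path_algebra_cadlag: "w \<in> space cadlag_path_algebra \<Longrightarrow> cadlag w"
  by (auto simp: cadlag_path_algebra_def space_restrict_space skorohod_space_def)

lemma measurable_cadlag_path:
  fixes X :: "real \<Rightarrow> 'a \<Rightarrow> real"
  assumes X: "\<And>t. 0 \<le> t \<Longrightarrow> X t \<in> borel_measurable M" "\<And>\<omega>. \<omega> \<in> space M \<Longrightarrow> cadlag (\<lambda>t. X t \<omega>)"
  shows "(\<lambda>\<omega>. \<lambda>t\<in>{0..}. X t \<omega>) \<in> M \<rightarrow>\<^sub>M cadlag_path_algebra"
  unfolding cadlag_path_algebra_def
proof (rule measurable_restrict_space2)
  show "(\<lambda>\<omega>. \<lambda>t\<in>{0..}. X t \<omega>) \<in> M \<rightarrow>\<^sub>M (\<Pi>\<^sub>M t\<in>{0..}. borel)"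
    using X(1) by (rule measurable_path)
  show "(\<lambda>\<omega>. \<lambda>t\<in>{0..}. X t \<omega>) \<in> space M \<rightarrow> skorohod_space"
    using restrict_cadlag_in_skorohod_space X(2) by blast
qed

lemma emeasure_cadlag_path:
  fixes X :: "real \<Rightarrow> 'a \<Rightarrow> real"
  assumes X: "\<And>t. 0 \<le> t \<Longrightarrow> X t \<in> borel_measurable M" "\<And>\<omega>. \<omega> \<in> space M \<Longrightarrow> cadlag (\<lambda>t. X t \<omega>)"
    and A: "A \<in> sets (\<Pi>\<^sub>M t\<in>{0..}. borel)"
  shows "emeasure (distr M cadlag_path_algebra (\<lambda>\<omega>. \<lambda>t\<in>{0..}. X t \<omega>)) (skorohod_space \<inter> A) =
    emeasure (path_law M X) A"
proof -
  have P: "(\<lambda>\<omega>. \<lambda>t\<in>{0..}. X t \<omega>) \<in> M \<rightarrow>\<^sub>M (\<Pi>\<^sub>M t\<in>{0..}. borel)"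
    using X(1) by (rule measurable_path)
  have G: "(\<lambda>\<omega>. \<lambda>t\<in>{0..}. X t \<omega>) \<in> M \<rightarrow>\<^sub>M cadlag_path_algebra"
    using X by (rule measurable_cadlag_path)
  have AG: "skorohod_space \<inter> A \<in> sets cadlag_path_algebra"
    using A by (auto simp: cadlag_path_algebra_def sets_restrict_space)
  have "(\<lambda>\<omega>. \<lambda>t\<in>{0..}. X t \<omega>) -` (skorohod_space \<inter> A) \<inter> space M =
      (\<lambda>\<omega>. \<lambda>t\<in>{0..}. X t \<omega>) -` A \<inter> space M"
    using restrict_cadlag_in_skorohod_space[OF X(2)] by blast
  then show ?thesis
    unfolding path_law_def by (simp only: emeasure_distr P G A AG)
qed

text \<open>On cadlag paths the identity is measurable from the coordinate \<open>\<sigma>\<close>-algebra to the Borel sets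
  of the Skorohod topology, so the finite-dimensional distributions determine the law there.\<close>

lemma skorohod_law_of_path_law:
  fixes X :: "real \<Rightarrow> 'a \<Rightarrow> real" and Y :: "real \<Rightarrow> 'b \<Rightarrow> real"
  assumes X: "\<And>t. 0 \<le> t \<Longrightarrow> X t \<in> borel_measurable M" "\<And>\<omega>. \<omega> \<in> space M \<Longrightarrow> cadlag (\<lambda>t. X t \<omega>)"
    and Y: "\<And>t. 0 \<le> t \<Longrightarrow> Y t \<in> borel_measurable N" "\<And>\<omega>. \<omega> \<in> space N \<Longrightarrow> cadlag (\<lambda>t. Y t \<omega>)"
    and law: "path_law M X = path_law N Y"
  shows "distr M (borel_of skorohod_topology) (\<lambda>\<omega>. \<lambda>t\<in>{0..}. X t \<omega>) =
         distr N (borel_of skorohod_topology) (\<lambda>\<omega>. \<lambda>t\<in>{0..}. Y t \<omega>)"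
proof -
  define I :: "(real \<Rightarrow> real) \<Rightarrow> real \<Rightarrow> real" where "I w = (\<lambda>t\<in>{0..}. w t)" for w
  have I: "I \<in> cadlag_path_algebra \<rightarrow>\<^sub>M borel_of skorohod_topology"
    unfolding I_def using cadlag_path_algebra_coordinate cadlag_path_algebra_cadlag
    by (rule cadlag_process_measurable)
  have FX: "(\<lambda>\<omega>. \<lambda>t\<in>{0..}. X t \<omega>) \<in> M \<rightarrow>\<^sub>M cadlag_path_algebra"
    using X by (rule measurable_cadlag_path)
  have FY: "(\<lambda>\<omega>. \<lambda>t\<in>{0..}. Y t \<omega>) \<in> N \<rightarrow>\<^sub>M cadlag_path_algebra"
    using Y by (rule measurable_cadlag_path)
  have "distr M cadlag_path_algebra (\<lambda>\<omega>. \<lambda>t\<in>{0..}. X t \<omega>) =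
      distr N cadlag_path_algebra (\<lambda>\<omega>. \<lambda>t\<in>{0..}. Y t \<omega>)"
  proof (rule measure_eqI)
    fix A assume "A \<in> sets (distr M cadlag_path_algebra (\<lambda>\<omega>. \<lambda>t\<in>{0..}. X t \<omega>))"
    then obtain A' where A': "A' \<in> sets (\<Pi>\<^sub>M t\<in>{0..}. borel)" "A = skorohod_space \<inter> A'"
      by (auto simp: cadlag_path_algebra_def sets_restrict_space)
    have "emeasure (distr M cadlag_path_algebra (\<lambda>\<omega>. \<lambda>t\<in>{0..}. X t \<omega>)) A = emeasure (path_law M X) A'"
      unfolding A'(2) using X A'(1) by (rule emeasure_cadlag_path)
    also have "\<dots> = emeasure (path_law N Y) A'" by (simp only: law)
    also have "\<dots> = emeasure (distr N cadlag_path_algebra (\<lambda>\<omega>. \<lambda>t\<in>{0..}. Y t \<omega>)) A"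
      unfolding A'(2) using Y A'(1) by (rule emeasure_cadlag_path[symmetric])
    finally show "emeasure (distr M cadlag_path_algebra (\<lambda>\<omega>. \<lambda>t\<in>{0..}. X t \<omega>)) A =
        emeasure (distr N cadlag_path_algebra (\<lambda>\<omega>. \<lambda>t\<in>{0..}. Y t \<omega>)) A" .
  qed simp
  then have "distr (distr M cadlag_path_algebra (\<lambda>\<omega>. \<lambda>t\<in>{0..}. X t \<omega>)) (borel_of skorohod_topology) I =
      distr (distr N cadlag_path_algebra (\<lambda>\<omega>. \<lambda>t\<in>{0..}. Y t \<omega>)) (borel_of skorohod_topology) I" by simp
  then show ?thesis
    unfolding distr_distr[OF I FX] distr_distr[OF I FY]
    by (simp add: comp_def I_def cong: restrict_cong)
qed

text \<open>The limit is realised as the coordinate process on the cadlag paths. Its \<open>\<sigma>\<close>-algebra is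
  generated by the coordinates, so that these are measurable by construction.\<close>

lemma cadlag_coordinate_process:
  fixes X :: "real \<Rightarrow> 'a \<Rightarrow> real"
  assumes "prob_space M"
    and X: "\<And>t. 0 \<le> t \<Longrightarrow> X t \<in> borel_measurable M" "\<And>\<omega>. \<omega> \<in> space M \<Longrightarrow> cadlag (\<lambda>t. X t \<omega>)"
  obtains N :: "(real \<Rightarrow> real) measure" where "prob_space N"
    "\<And>t. 0 \<le> t \<Longrightarrow> (\<lambda>w. w t) \<in> borel_measurable N" "\<And>w. w \<in> space N \<Longrightarrow> cadlag w"
    "path_law N (\<lambda>t w. w t) = path_law M X"
proof -
  interpret M: prob_space M by fact
  have F: "(\<lambda>\<omega>. \<lambda>t\<in>{0..}. X t \<omega>) \<in> M \<rightarrow>\<^sub>M cadlag_path_algebra"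
    using X by (rule measurable_cadlag_path)
  have I: "(\<lambda>w. \<lambda>t\<in>{0..}. w t) \<in> cadlag_path_algebra \<rightarrow>\<^sub>M (\<Pi>\<^sub>M t\<in>{0::real..}. borel)"
    using cadlag_path_algebra_coordinate by (rule measurable_path)
  show thesis
  proof (rule that[of "distr M cadlag_path_algebra (\<lambda>\<omega>. \<lambda>t\<in>{0..}. X t \<omega>)"])
    show "prob_space (distr M cadlag_path_algebra (\<lambda>\<omega>. \<lambda>t\<in>{0..}. X t \<omega>))"
      by (rule M.prob_space_distr[OF F])
    show "path_law (distr M cadlag_path_algebra (\<lambda>\<omega>. \<lambda>t\<in>{0..}. X t \<omega>)) (\<lambda>t w. w t) = path_law M X"
      unfolding path_law_def distr_distr[OF I F] by (simp add: comp_def cong: restrict_cong)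
  qed (simp_all add: cadlag_path_algebra_coordinate cadlag_path_algebra_cadlag)
qed

section \<open>Convergence together with processes of a fixed law\<close>

lemma borel_measurable_continuous_map:
  assumes "continuous_map T euclideanreal f"
  shows "f \<in> borel_measurable (borel_of T)"
proof (rule borel_measurableI)
  fix S :: "real set" assume "open S"
  then have "openin T {x \<in> topspace T. f x \<in> S}"
    using assms by (intro openin_continuous_map_preimage) auto
  moreover have "{x \<in> topspace T. f x \<in> S} = f -` S \<inter> space (borel_of T)" by auto
  ultimately show "f -` S \<inter> space (borel_of T) \<in> sets (borel_of T)"
    by (simp add: sets_borel_of_openin)
qed

text \<open>Since a bounded continuous function on a metric space need not be uniformly continuous, the
  closeness of \<open>X i\<close> and \<open>Y i\<close> does not directly control \<open>f (X i) - f (Y i)\<close>. But the points at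
  which \<open>f\<close> varies by more than \<open>e\<close> within distance \<open>1/k\<close> form open sets that decrease to the empty
  set, and the \<open>Y i\<close>, having a fixed law, charge these sets little, uniformly in \<open>i\<close>.\<close>

lemma (in Metric_space) weakly_converges_of_close:
  fixes X Y :: "'i \<Rightarrow> 'p \<Rightarrow> 'a"
  assumes "prob_space N" and \<mu>: "finite_measure \<mu>" "sets \<mu> = sets (borel_of mtopology)"
    and X: "\<forall>\<^sub>F i in F. X i \<in> N \<rightarrow>\<^sub>M borel_of mtopology"
    and Y: "\<forall>\<^sub>F i in F. Y i \<in> N \<rightarrow>\<^sub>M borel_of mtopology \<and> distr N (borel_of mtopology) (Y i) = \<mu>"
    and close: "\<And>\<delta> \<eta>. 0 < \<delta> \<Longrightarrow> 0 < \<eta> \<Longrightarrow>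
      \<forall>\<^sub>F i in F. \<exists>A\<in>sets N. measure N A \<le> \<eta> \<and> (\<forall>\<omega>\<in>space N - A. d (X i \<omega>) (Y i \<omega>) < \<delta>)"
  shows "weakly_converges mtopology (\<lambda>i. distr N (borel_of mtopology) (X i)) \<mu> F"
  unfolding weakly_converges_def
proof (intro allI impI)
  interpret N: prob_space N by fact
  interpret \<mu>: finite_measure \<mu> by fact
  have space_\<mu>: "space \<mu> = M" using sets_eq_imp_space_eq[OF \<mu>(2)] by simp
  fix f assume "continuous_map mtopology euclideanreal f \<and> bounded (f ` topspace mtopology)"
  then have f: "continuous_map mtopology euclideanreal f" and "bounded (f ` M)" by auto
  then obtain B where "0 < B" and B: "\<And>x. x \<in> M \<Longrightarrow> \<bar>f x\<bar> \<le> B"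
    unfolding bounded_pos by auto
  note fm = borel_measurable_continuous_map[OF f]
  show "((\<lambda>i. \<integral>x. f x \<partial>distr N (borel_of mtopology) (X i)) \<longlongrightarrow> (\<integral>x. f x \<partial>\<mu>)) F"
  proof (rule tendstoI)
    fix e :: real assume e: "0 < e"
    define U where "U x = {y \<in> topspace mtopology. f y \<in> {r. e/3 < \<bar>f x - r\<bar>}}" for x
    define V where "V k = (\<Union>x\<in>M. mball x (1 / real (Suc k)) \<inter> U x)" for k
    have U: "openin mtopology (U x)" for x
      unfolding U_def
    proof (rule openin_continuous_map_preimage[OF f])
      show "openin euclideanreal {r. e/3 < \<bar>f x - r\<bar>}"
        unfolding open_openin[symmetric] by (intro open_Collect_less continuous_intros)
    qed
    have V_sets: "V k \<in> sets \<mu>" for k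
      unfolding \<mu>(2) V_def using U by (intro sets_borel_of_openin openin_Union) auto
    have "(\<lambda>k. measure \<mu> (V k)) \<longlonglongrightarrow> measure \<mu> (\<Inter>k. V k)"
    proof (rule \<mu>.finite_Lim_measure_decseq)
      show "range V \<subseteq> sets \<mu>" using V_sets by auto
      have "mball x (1 / real (Suc l)) \<subseteq> mball x (1 / real (Suc k))" if "k \<le> l" for k l x
        using that by (intro mball_subset_concentric divide_left_mono) auto
      then show "decseq V"
        unfolding decseq_def V_def by (intro allI impI UN_mono Int_mono) auto
    qed
    also have "(\<Inter>k. V k) = {}"
    proof (rule equals0I)
      fix y assume y: "y \<in> (\<Inter>k. V k)"
      then have yM: "y \<in> M" by (auto simp: V_def)
      have "openin mtopology {x \<in> topspace mtopology. f x \<in> ball (f y) (e/3)}"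
        by (rule openin_continuous_map_preimage[OF f]) auto
      then obtain r where r: "0 < r" "mball y r \<subseteq> {x \<in> topspace mtopology. f x \<in> ball (f y) (e/3)}"
        using yM e unfolding openin_mtopology by auto
      obtain k where k: "1 / real (Suc k) < r" using nat_approx_posE[OF r(1)] by auto
      obtain x where x: "x \<in> M" "y \<in> mball x (1 / real (Suc k))" "y \<in> U x"
        using y unfolding V_def by blast
      then have "x \<in> mball y r" using k commute[of x y] by auto
      then have "dist (f y) (f x) < e/3" using r(2) by auto
      with x(3) show False by (simp add: U_def dist_real_def abs_minus_commute)
    qed
    finally have V_lim: "(\<lambda>k. measure \<mu> (V k)) \<longlonglongrightarrow> 0" by simp
    define \<eta> where "\<eta> = e / (6 * B)"
    have \<eta>: "0 < \<eta>" using e \<open>0 < B\<close> by (simp add: \<eta>_def)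
    obtain k where k: "measure \<mu> (V k) < \<eta>/2"
      using order_tendstoD(2)[OF V_lim, of "\<eta>/2"] \<eta> by (auto simp: eventually_sequentially)
    have "\<forall>\<^sub>F i in F. \<exists>A\<in>sets N. measure N A \<le> \<eta>/2 \<and> (\<forall>\<omega>\<in>space N - A. d (X i \<omega>) (Y i \<omega>) < 1 / real (Suc k))"
      using \<eta> by (intro close) auto
    with X Y show "\<forall>\<^sub>F i in F. dist (\<integral>x. f x \<partial>distr N (borel_of mtopology) (X i)) (\<integral>x. f x \<partial>\<mu>) < e"
    proof eventually_elim
      case (elim i)
      then have Xi: "X i \<in> N \<rightarrow>\<^sub>M borel_of mtopology" and Yi: "Y i \<in> N \<rightarrow>\<^sub>M borel_of mtopology"
        and law: "\<mu> = distr N (borel_of mtopology) (Y i)" by auto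
      from elim obtain A where A: "A \<in> sets N" "measure N A \<le> \<eta>/2"
        "\<And>\<omega>. \<omega> \<in> space N - A \<Longrightarrow> d (X i \<omega>) (Y i \<omega>) < 1 / real (Suc k)" by blast
      define C where "C = A \<union> (Y i -` V k \<inter> space N)"
      have Vk: "Y i -` V k \<inter> space N \<in> sets N"
        using measurable_sets[OF Yi] V_sets[of k] \<mu>(2) by simp
      then have C: "C \<in> sets N" using A by (simp add: C_def)
      have "measure N (Y i -` V k \<inter> space N) = measure \<mu> (V k)"
        unfolding law using V_sets[of k] by (subst measure_distr[OF Yi]) (simp_all add: \<mu>(2))
      then have mC: "measure N C < \<eta>"
        using measure_Un_le[OF A(1) Vk] A(2) k by (simp add: C_def)
      have XM: "X i \<omega> \<in> M" and YM: "Y i \<omega> \<in> M" if "\<omega> \<in> space N" for \<omega>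
        using measurable_space[OF Xi that] measurable_space[OF Yi that] by auto
      have fX: "(\<lambda>\<omega>. f (X i \<omega>)) \<in> borel_measurable N" and fY: "(\<lambda>\<omega>. f (Y i \<omega>)) \<in> borel_measurable N"
        using measurable_compose[OF Xi fm] measurable_compose[OF Yi fm] by auto
      have intX: "integrable N (\<lambda>\<omega>. f (X i \<omega>))" and intY: "integrable N (\<lambda>\<omega>. f (Y i \<omega>))"
        by (auto intro!: N.integrable_const_bound[where B = B] fX fY AE_I2 B XM YM)
      have bound: "\<bar>f (X i \<omega>) - f (Y i \<omega>)\<bar> \<le> e/3 + 2 * B * indicator C \<omega>" if w: "\<omega> \<in> space N" for \<omega>
      proof (cases "\<omega> \<in> C")
        case True
        then show ?thesis using B[OF XM[OF w]] B[OF YM[OF w]] e by simp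
      next
        case False
        then have "Y i \<omega> \<notin> V k" "d (X i \<omega>) (Y i \<omega>) < 1 / real (Suc k)"
          using A(3)[of \<omega>] w by (auto simp: C_def)
        then have "Y i \<omega> \<notin> U (X i \<omega>)" using XM[OF w] YM[OF w] unfolding V_def by auto
        then show ?thesis using YM[OF w] False by (simp add: U_def)
      qed
      have intC': "integrable N (\<lambda>\<omega>. 2 * B * indicator C \<omega> :: real)"
        using C by (intro integrable_mult_right integrable_real_indicator) (auto simp: less_top[symmetric])
      then have intC: "integrable N (\<lambda>\<omega>. e/3 + 2 * B * indicator C \<omega>)"
        by (intro Bochner_Integration.integrable_add) auto
      have "(\<integral>x. f x \<partial>distr N (borel_of mtopology) (X i)) - (\<integral>x. f x \<partial>\<mu>) = (\<integral>\<omega>. f (X i \<omega>) - f (Y i \<omega>) \<partial>N)"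
        unfolding law integral_distr[OF Xi fm] integral_distr[OF Yi fm]
        using intX intY by simp
      also have "\<bar>\<dots>\<bar> \<le> (\<integral>\<omega>. \<bar>f (X i \<omega>) - f (Y i \<omega>)\<bar> \<partial>N)" by (rule integral_abs_bound)
      also have "\<dots> \<le> (\<integral>\<omega>. e/3 + 2 * B * indicator C \<omega> \<partial>N)"
        using intX intY intC bound by (intro integral_mono) auto
      also have "\<dots> = e/3 + 2 * B * measure N C"
        using C intC' by (simp add: N.prob_space)
      also have "\<dots> < e/3 + 2 * B * \<eta>" using mC \<open>0 < B\<close> by simp
      also have "\<dots> = 2 * e / 3" using \<open>0 < B\<close> by (simp add: \<eta>_def)
      also have "\<dots> < e" using e by simp
      finally show ?case by (simp add: dist_real_def)
    qed
  qed
qed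

section \<open>The winding angle before leaving a neighbourhood of the starting point\<close>

text \<open>While \<open>z\<close> stays in the disc of radius \<open>1/2\<close> around \<open>1\<close>, the principal argument has jumps
  smaller than \<open>\<pi>\<close>. Hence the difference to the winding angle has jumps smaller than \<open>2\<pi>\<close>, but its
  values lie in \<open>2\<pi>\<int>\<close>. So it is continuous, constant, and zero because it is small at time \<open>0\<close>.\<close>

lemma winding_of_eq_Im_Ln:
  assumes w: "winding_of z \<theta>" and z: "cadlag z"
    and near: "\<And>u. u \<in> {0..s} \<Longrightarrow> cmod (z u - 1) \<le> 1/2" and t: "t \<in> {0..s}"
  shows "\<theta> t = Im (Ln (z t))"
proof -
  have \<theta>: "cadlag \<theta>" "\<theta> 0 = 0" and e\<theta>: "\<And>t. 0 \<le> t \<Longrightarrow> exp (\<i> * of_real (\<theta> t)) = z t / of_real (cmod (z t))"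
    and jump: "\<And>t. 0 < t \<Longrightarrow> \<bar>\<theta> t - Lim (at_left t) \<theta>\<bar> < pi"
    using w by (auto simp: winding_of_def)
  have Re_pos: "0 < Re y" if "cmod (y - 1) \<le> 1/2" for y
    using that abs_Re_le_cmod[of "y - 1"] by auto
  define \<phi> where "\<phi> y = Im (Ln y)" for y
  have \<phi>: "\<bar>\<phi> y\<bar> < pi/2" and y0: "y \<noteq> 0" and cont: "isCont \<phi> y" if "cmod (y - 1) \<le> 1/2" for y
  proof -
    have "y \<notin> \<real>\<^sub>\<le>\<^sub>0" using Re_pos[OF that] by (auto simp: complex_nonpos_Reals_iff)
    then show "isCont \<phi> y" unfolding \<phi>_def by (intro isCont_Im isCont_Ln')  auto
    show "y \<noteq> 0" using Re_pos[OF that] by auto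
    then show "\<bar>\<phi> y\<bar> < pi/2" unfolding \<phi>_def using Re_pos[OF that] Re_Ln_pos_lt by blast
  qed
  define D where "D u = \<theta> u - \<phi> (z u)" for u
  have eD: "exp (\<i> * of_real (D u)) = 1" if "u \<in> {0..s}" for u
  proof -
    have "z u \<noteq> 0" using y0[OF near[OF that]] .
    then have "z u = exp (of_real (ln (cmod (z u))) + \<i> * of_real (\<phi> (z u)))"
      using exp_Ln[of "z u"] complex_eq[of "Ln (z u)"] by (simp add: \<phi>_def)
    also have "\<dots> = of_real (cmod (z u)) * exp (\<i> * of_real (\<phi> (z u)))"
      using \<open>z u \<noteq> 0\<close> by (simp add: exp_add exp_of_real)
    finally have "of_real (cmod (z u)) * exp (\<i> * of_real (\<phi> (z u))) = z u" by (rule sym)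
    moreover have "of_real (cmod (z u)) * exp (\<i> * of_real (\<theta> u)) = z u"
      using \<open>z u \<noteq> 0\<close> e\<theta>[of u] that by simp
    ultimately have "of_real (cmod (z u)) * exp (\<i> * of_real (\<phi> (z u))) =
        of_real (cmod (z u)) * exp (\<i> * of_real (\<theta> u))" by (simp only:)
    then have "exp (\<i> * of_real (\<phi> (z u))) = exp (\<i> * of_real (\<theta> u))"
      using \<open>z u \<noteq> 0\<close> by (simp only: mult_cancel_left) simp
    then show ?thesis by (simp add: D_def right_diff_distrib exp_diff)
  qed
  have small_zero: "r = 0" if er: "exp (\<i> * of_real r) = 1" and r: "\<bar>r\<bar> < 2 * pi" for r :: real
  proof -
    obtain n :: int where n: "r = of_int (2 * n) * pi" using er unfolding exp_eq_1 by auto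
    then have "\<bar>real_of_int n\<bar> * (2 * pi) < 1 * (2 * pi)" using r by (simp add: abs_mult)
    then have "\<bar>real_of_int n\<bar> < 1" by (rule mult_right_less_imp_less) simp
    then have "n = 0" by linarith
    with n show ?thesis by simp
  qed
  have right: "(D \<longlongrightarrow> D u) (at_right u)" if u: "u \<in> {0..s}" for u
    unfolding D_def using \<theta>(1) z u
    by (intro tendsto_diff isCont_tendsto_compose[OF cont[OF near[OF u]]]) (auto simp: cadlag_def)
  have left: "(D \<longlongrightarrow> D u) (at_left u)" if u: "u \<in> {0..s}" "0 < u" for u
  proof -
    obtain l where l: "(z \<longlongrightarrow> l) (at_left u)" using z u unfolding cadlag_def by blast
    have ev: "\<forall>\<^sub>F v in at_left u. v \<in> {0..s}"
      using u by (auto simp: eventually_at_left_field intro!: exI[of _ 0])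
    have l1: "cmod (l - 1) \<le> 1/2"
    proof (rule tendsto_upperbound)
      show "((\<lambda>v. cmod (z v - 1)) \<longlongrightarrow> cmod (l - 1)) (at_left u)" by (intro tendsto_intros l)
      show "\<forall>\<^sub>F v in at_left u. cmod (z v - 1) \<le> 1/2" using ev by eventually_elim (rule near)
    qed simp
    obtain l\<theta> where l\<theta>: "(\<theta> \<longlongrightarrow> l\<theta>) (at_left u)" using \<theta>(1) u unfolding cadlag_def by blast
    then have "Lim (at_left u) \<theta> = l\<theta>" by (intro tendsto_Lim) auto
    with jump[OF u(2)] have j: "\<bar>\<theta> u - l\<theta>\<bar> < pi" by simp
    have lD: "(D \<longlongrightarrow> l\<theta> - \<phi> l) (at_left u)"
      unfolding D_def by (intro tendsto_diff l\<theta> isCont_tendsto_compose[OF cont[OF l1] l])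
    then have "((\<lambda>v. exp (\<i> * of_real (D v))) \<longlongrightarrow> exp (\<i> * of_real (l\<theta> - \<phi> l))) (at_left u)"
      by (intro tendsto_intros)
    moreover have "((\<lambda>v. exp (\<i> * of_real (D v))) \<longlongrightarrow> 1) (at_left u)"
      by (rule tendsto_eventually, rule eventually_mono[OF ev], rule eD)
    ultimately have "exp (\<i> * of_real (l\<theta> - \<phi> l)) = 1"
      by (intro tendsto_unique[of "at_left u"]) auto
    then have "exp (\<i> * of_real (D u - (l\<theta> - \<phi> l))) = 1"
      using eD[OF u(1)] by (simp add: right_diff_distrib exp_diff)
    moreover have "\<bar>D u - (l\<theta> - \<phi> l)\<bar> < 2 * pi"
      using j \<phi>[OF l1] \<phi>[OF near[OF u(1)]] by (simp add: D_def)
    ultimately have "D u = l\<theta> - \<phi> l" using small_zero by fastforce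
    with lD show ?thesis by simp
  qed
  have "continuous_on {0..s} D"
    unfolding continuous_on_def
  proof
    fix u assume u: "u \<in> {0..s}"
    have "(D \<longlongrightarrow> D u) (at u within {0..<u})"
    proof (cases "0 < u")
      case True
      show ?thesis by (rule tendsto_within_subset[OF left[OF u True]]) auto
    next
      case False
      then show ?thesis using u by simp
    qed
    moreover have "(D \<longlongrightarrow> D u) (at u within {u<..s})"
      by (rule tendsto_within_subset[OF right[OF u]]) auto
    ultimately have "(D \<longlongrightarrow> D u) (at u within ({0..<u} \<union> {u<..s}))"
      by (rule Lim_Un)
    moreover have "({0..<u} \<union> {u<..s}) - {u} = {0..s} - {u}" using u by auto
    then have "at u within ({0..<u} \<union> {u<..s}) = at u within {0..s}" by (simp only: at_within_def)
    ultimately show "(D \<longlongrightarrow> D u) (at u within {0..s})" by simp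
  qed
  moreover have "\<exists>r>0. \<forall>v. v \<in> {0..s} \<and> D v \<noteq> D u \<longrightarrow> r \<le> norm (D v - D u)" if u: "u \<in> {0..s}" for u
  proof (intro exI[of _ "2 * pi"] conjI allI impI)
    fix v assume v: "v \<in> {0..s} \<and> D v \<noteq> D u"
    have "exp (\<i> * of_real (D v - D u)) = 1"
      using eD u v by (simp add: right_diff_distrib exp_diff)
    then show "2 * pi \<le> norm (D v - D u)" using small_zero[of "D v - D u"] v by force
  qed simp
  ultimately have "D constant_on {0..s}"
    by (intro continuous_discrete_range_constant) auto
  then have "D t = D 0" using t by (auto simp: constant_on_def)
  moreover have "D 0 = 0"
  proof (rule small_zero)
    have 0: "0 \<in> {0..s}" using t by auto
    show "exp (\<i> * of_real (D 0)) = 1" by (rule eD[OF 0])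
    have "D 0 = - \<phi> (z 0)" by (simp add: D_def \<theta>)
    then show "\<bar>D 0\<bar> < 2 * pi" using \<phi>[OF near[OF 0]] pi_gt_zero by linarith
  qed
  ultimately show ?thesis by (simp add: D_def \<phi>_def)
qed

lemma abs_Im_Ln_diff_Im_le:
  assumes "cmod y \<le> 1/2"
  shows "\<bar>Im (Ln (1 + y)) - Im y\<bar> \<le> 2 * (cmod y)\<^sup>2"
proof -
  have "\<bar>Im (Ln (1 + y)) - Im y\<bar> \<le> cmod (Ln (1 + y) - y)"
    using abs_Im_le_cmod[of "Ln (1 + y) - y"] by simp
  also have "\<dots> \<le> (cmod y)\<^sup>2 / (1 - cmod y)" using assms by (intro Ln_approx_linear) simp
  also have "\<dots> \<le> (cmod y)\<^sup>2 / (1/2)" using assms by (intro divide_left_mono) auto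
  finally show ?thesis by simp
qed

lemma abs_winding_diff_Im_le:
  assumes "winding_of z \<theta>" and "cadlag z" and s: "0 \<le> s"
    and near: "\<And>u. u \<in> {0..s} \<Longrightarrow> cmod (z u - 1) \<le> r" and r: "r \<le> 1/2"
  shows "\<bar>\<theta> s - Im (z s - 1)\<bar> \<le> 2 * r\<^sup>2"
proof -
  have zs: "cmod (z s - 1) \<le> r" using near[of s] s by auto
  have "\<theta> s = Im (Ln (z s))"
    by (rule winding_of_eq_Im_Ln[OF assms(1,2), of s]) (use order_trans[OF near r] s in auto)
  then have "\<bar>\<theta> s - Im (z s - 1)\<bar> \<le> 2 * (cmod (z s - 1))\<^sup>2"
    using abs_Im_Ln_diff_Im_le[of "z s - 1"] zs r by simp
  also have "\<dots> \<le> 2 * r\<^sup>2" using power_mono[OF zs, of 2] by simp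
  finally show ?thesis .
qed

section \<open>Suprema over rational times\<close>

text \<open>Restricting to rational times keeps the event measurable; right continuity recovers the
  other times before \<open>T\<close>.\<close>

definition exceeds :: "(real \<Rightarrow> 'a \<Rightarrow> real) \<Rightarrow> nat \<Rightarrow> real \<Rightarrow> 'a set" where
  "exceeds X T K = (\<Union>q\<in>\<rat> \<inter> {0..real T}. {\<omega>. K < \<bar>X q \<omega>\<bar>})"

lemma sets_exceeds:
  assumes "\<And>t. 0 \<le> t \<Longrightarrow> X t \<in> borel_measurable M"
  shows "exceeds X T K \<inter> space M \<in> sets M"
proof -
  have "exceeds X T K \<inter> space M = (\<Union>q\<in>\<rat> \<inter> {0..real T}. {\<omega>\<in>space M. K < \<bar>X q \<omega>\<bar>})"
    by (auto simp: exceeds_def)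
  also have "\<dots> \<in> sets M"
  proof (rule sets.countable_UN'')
    show "countable (\<rat> \<inter> {0..real T})" using countable_rat by (rule countable_subset[rotated]) auto
    fix q assume "q \<in> \<rat> \<inter> {0..real T}"
    then have [measurable]: "X q \<in> borel_measurable M" using assms by auto
    show "{\<omega>\<in>space M. K < \<bar>X q \<omega>\<bar>} \<in> sets M" by measurable
  qed
  finally show ?thesis .
qed

lemma measure_exceeds_path_law:
  assumes X: "\<And>t. 0 \<le> t \<Longrightarrow> X t \<in> borel_measurable M"
  shows "measure M (exceeds X T K \<inter> space M) =
    measure (path_law M X) (exceeds (\<lambda>t w. w t) T K \<inter> space (\<Pi>\<^sub>M t\<in>{0..}. borel))"
proof -
  have "exceeds (\<lambda>t w. w t) T K \<inter> space (\<Pi>\<^sub>M t\<in>{0..}. borel) \<in> sets (\<Pi>\<^sub>M t\<in>{0::real..}. borel :: real measure)"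
    by (intro sets_exceeds measurable_component_singleton) auto
  moreover have "(\<lambda>\<omega>. \<lambda>t\<in>{0..}. X t \<omega>) -` (exceeds (\<lambda>t w. w t) T K \<inter> space (\<Pi>\<^sub>M t\<in>{0..}. borel)) \<inter> space M
      = exceeds X T K \<inter> space M"
    by (force simp: exceeds_def space_PiM)
  ultimately show ?thesis
    unfolding path_law_def using X by (subst measure_distr) (auto intro: measurable_path)
qed

lemma abs_le_of_not_exceeds:
  assumes cad: "cadlag (\<lambda>t. X t \<omega>)" and "\<omega> \<notin> exceeds X T K" and t: "0 \<le> t" "t < real T"
  shows "\<bar>X t \<omega>\<bar> \<le> K"
proof (rule ccontr)
  assume "\<not> \<bar>X t \<omega>\<bar> \<le> K"
  moreover have "((\<lambda>s. \<bar>X s \<omega>\<bar>) \<longlongrightarrow> \<bar>X t \<omega>\<bar>) (at_right t)"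
    using cad t by (intro tendsto_rabs) (auto simp: cadlag_def)
  ultimately have "\<forall>\<^sub>F s in at_right t. K < \<bar>X s \<omega>\<bar>" by (intro order_tendstoD(1)) auto
  then obtain b where b: "t < b" "\<And>s. t < s \<Longrightarrow> s < b \<Longrightarrow> K < \<bar>X s \<omega>\<bar>"
    unfolding eventually_at_right_field by blast
  obtain q where "q \<in> \<rat>" "t < q" "q < min b (real T)"
    using Rats_dense_in_real[of t "min b (real T)"] b t by auto
  then show False using assms(2) b(2)[of q] t by (auto simp: exceeds_def)
qed

lemma exceeds_tail:
  fixes X :: "real \<Rightarrow> 'a \<Rightarrow> real"
  assumes "prob_space M" and X: "\<And>t. 0 \<le> t \<Longrightarrow> X t \<in> borel_measurable M"
    and cad: "\<And>\<omega>. \<omega> \<in> space M \<Longrightarrow> cadlag (\<lambda>t. X t \<omega>)" and \<eta>: "0 < \<eta>"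
  obtains K where "0 < K" "measure M (exceeds X T K \<inter> space M) < \<eta>"
proof -
  interpret M: prob_space M by fact
  have "(\<lambda>k. measure M (exceeds X T (real k) \<inter> space M)) \<longlonglongrightarrow> measure M (\<Inter>k. exceeds X T (real k) \<inter> space M)"
  proof (rule M.finite_Lim_measure_decseq)
    show "range (\<lambda>k. exceeds X T (real k) \<inter> space M) \<subseteq> sets M" using sets_exceeds[OF X] by auto
    show "decseq (\<lambda>k. exceeds X T (real k) \<inter> space M)"
      unfolding decseq_def exceeds_def by (auto intro: le_less_trans)
  qed
  also have "(\<Inter>k. exceeds X T (real k) \<inter> space M) = {}"
  proof (rule equals0I)
    fix \<omega> assume w: "\<omega> \<in> (\<Inter>k. exceeds X T (real k) \<inter> space M)"
    then have "\<omega> \<in> space M" by auto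
    from cadlag_bounded_on_interval[OF cad[OF this], of "real T"]
    obtain B where B: "\<And>t. t \<in> {0..real T} \<Longrightarrow> \<bar>X t \<omega>\<bar> \<le> B" by auto
    obtain k :: nat where "B < real k" using reals_Archimedean2 by blast
    moreover have "\<omega> \<in> exceeds X T (real k)" using w by auto
    ultimately show False using B by (fastforce simp: exceeds_def)
  qed
  finally have "(\<lambda>k. measure M (exceeds X T (real k) \<inter> space M)) \<longlonglongrightarrow> 0" by simp
  then have "\<forall>\<^sub>F k in sequentially. measure M (exceeds X T (real k) \<inter> space M) < \<eta> \<and> 0 < k"
    by (intro eventually_conj order_tendstoD(2)[OF _ \<eta>] eventually_gt_at_top)
  then obtain k where "measure M (exceeds X T (real k) \<inter> space M) < \<eta>" "0 < k"
    by (auto simp: eventually_sequentially)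
  then show thesis by (intro that[of "real k"]) auto
qed

section \<open>Small time limit of the winding process\<close>

theorem theorem4p4:
  fixes \<alpha> :: real and M :: "'a measure"
    and Z :: "real \<Rightarrow> 'a \<Rightarrow> complex" and \<theta> :: "real \<Rightarrow> 'a \<Rightarrow> real"
  assumes "0 < \<alpha>" and "\<alpha> < 2"
    and "isotropic_stable_process M \<alpha> 1 1 Z"
    and "winding_process M Z \<theta>"
  shows "\<exists>\<kappa>>0. \<exists>(N :: (real \<Rightarrow> real) measure) (\<zeta> :: real \<Rightarrow> (real \<Rightarrow> real) \<Rightarrow> real).
           isotropic_stable_process N \<alpha> \<kappa> 0 \<zeta> \<and>
           converges_in_distribution skorohod_topology
             M (\<lambda>c \<omega>. \<lambda>t\<in>{0..}. c powr (- 1 / \<alpha>) * \<theta> (c * t) \<omega>)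
             N (\<lambda>\<omega>. \<lambda>t\<in>{0..}. \<zeta> t \<omega>)
             (at_right (0 :: real))"
proof -
  interpret Z: isotropic_stable_process M \<alpha> 1 1 Z by fact
  interpret S: Metric_space skorohod_space skorohod_dist by (rule skorohod_Metric_space)
  have \<theta>: "\<And>t. 0 \<le> t \<Longrightarrow> \<theta> t \<in> borel_measurable M" "\<And>\<omega>. \<omega> \<in> space M \<Longrightarrow> cadlag (\<lambda>t. \<theta> t \<omega>)"
    and wind: "AE \<omega> in M. winding_of (\<lambda>t. Z t \<omega>) (\<lambda>t. \<theta> t \<omega>)"
    using assms(4) by (auto simp: winding_process_def)
  have "AE \<omega> in M. cadlag (\<lambda>t. Z t \<omega>) \<and> winding_of (\<lambda>t. Z t \<omega>) (\<lambda>t. \<theta> t \<omega>)"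
    using Z.cadlag_paths wind by eventually_elim simp
  then obtain E where E: "E \<in> null_sets M"
    and off: "\<And>\<omega>. \<omega> \<in> space M - E \<Longrightarrow> cadlag (\<lambda>t. Z t \<omega>) \<and> winding_of (\<lambda>t. Z t \<omega>) (\<lambda>t. \<theta> t \<omega>)"
    unfolding eventually_ae_filter by blast

  \<comment> \<open>Rescaled projections of the displacement, set to zero on the exceptional null set to make
    all their paths cadlag.\<close>
  define W where "W v c t \<omega> = (if \<omega> \<in> E then 0 else c powr (- 1 / \<alpha>) * (v \<bullet> (Z (c * t) \<omega> - 1)))"
    for v :: complex and c t \<omega>
  have W_meas: "W v c t \<in> borel_measurable M" if "0 < c" "0 \<le> t" for v c t
  proof -
    have [measurable]: "Z (c * t) \<in> borel_measurable M" using that by (intro Z.random_variable_at) simp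
    have [measurable]: "E \<in> sets M" using E by auto
    show ?thesis unfolding W_def by measurable
  qed
  have W_cad: "cadlag (\<lambda>t. W v c t \<omega>)" if "0 < c" "\<omega> \<in> space M" for v c \<omega>
  proof (cases "\<omega> \<in> E")
    case True
    then show ?thesis by (auto simp: W_def cadlag_def)
  next
    case False
    have "cadlag (\<lambda>t. c powr (- 1 / \<alpha>) * (v \<bullet> (Z (c * t) \<omega> - 1)))"
      using off[of \<omega>] False that
      by (intro cadlag_rescale[where f = "\<lambda>y. c powr (- 1 / \<alpha>) * (v \<bullet> (y - 1))"]) (auto intro!: continuous_intros)
    then show ?thesis by (simp add: W_def False)
  qed
  have W_stable: "isotropic_stable_process M \<alpha> 1 0 (W v c)" if "0 < c" "norm v = 1" for v c
  proof (rule isotropic_stable_process_of_path_law)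
    show stable: "isotropic_stable_process M \<alpha> 1 0 (\<lambda>t \<omega>. c powr (- 1 / \<alpha>) * (v \<bullet> (Z (c * t) \<omega> - 1)))"
      by (rule stable_projection_rescale[OF assms(3,1) that])
    then interpret V: isotropic_stable_process M \<alpha> 1 0 "\<lambda>t \<omega>. c powr (- 1 / \<alpha>) * (v \<bullet> (Z (c * t) \<omega> - 1))" .
    show "prob_space M" by (rule Z.prob_space_axioms)
    show "W v c t \<in> borel_measurable M" if "0 \<le> t" for t by (rule W_meas[OF \<open>0 < c\<close> that])
    show "AE \<omega> in M. cadlag (\<lambda>t. W v c t \<omega>)" using W_cad[OF \<open>0 < c\<close>] by (intro AE_I2)
    have "AE \<omega> in M. \<forall>t\<ge>0. W v c t \<omega> = c powr (- 1 / \<alpha>) * (v \<bullet> (Z (c * t) \<omega> - 1))"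
      using AE_not_in[OF E] by eventually_elim (simp add: W_def)
    with W_meas[OF \<open>0 < c\<close>] V.random_variable_at
    show "path_law M (W v c) = path_law M (\<lambda>t \<omega>. c powr (- 1 / \<alpha>) * (v \<bullet> (Z (c * t) \<omega> - 1)))"
      by (rule path_law_cong_AE)
  qed
  have W_law: "path_law M (W v c) = path_law M (W \<i> 1)" if "0 < c" "norm v = 1" for v c
    by (rule stable_path_law_unique) (auto intro!: W_stable that)

  obtain N :: "(real \<Rightarrow> real) measure" where N: "prob_space N"
    and N_meas: "\<And>t. 0 \<le> t \<Longrightarrow> (\<lambda>w. w t) \<in> borel_measurable N"
    and N_cad: "\<And>w. w \<in> space N \<Longrightarrow> cadlag w"
    and N_law: "path_law N (\<lambda>t w. w t) = path_law M (W \<i> 1)"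
    using cadlag_coordinate_process[of M "W \<i> 1"] Z.prob_space_axioms W_meas W_cad zero_less_one by metis
  define \<zeta> where "\<zeta> t w = w t" for t and w :: "real \<Rightarrow> real"
  define \<mu> where "\<mu> = distr N (borel_of skorohod_topology) (\<lambda>w. \<lambda>t\<in>{0..}. \<zeta> t w)"
  have stable: "isotropic_stable_process N \<alpha> 1 0 \<zeta>"
    unfolding \<zeta>_def
  proof (rule isotropic_stable_process_of_path_law)
    show "isotropic_stable_process M \<alpha> 1 0 (W \<i> 1)" by (rule W_stable) auto
    show "AE w in N. cadlag (\<lambda>t. w t)" using N_cad by (intro AE_I2)
  qed (fact N N_meas N_law)+
  have \<zeta>: "(\<lambda>w. \<lambda>t\<in>{0..}. \<zeta> t w) \<in> N \<rightarrow>\<^sub>M borel_of skorohod_topology"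
    unfolding \<zeta>_def using N_meas N_cad by (rule cadlag_process_measurable)
  have \<mu>: "finite_measure \<mu>" "sets \<mu> = sets (borel_of skorohod_topology)"
    unfolding \<mu>_def using prob_space.finite_measure[OF prob_space.prob_space_distr[OF N \<zeta>]] by simp_all
  define X where "X c \<omega> = (\<lambda>t\<in>{0..}. c powr (- 1 / \<alpha>) * \<theta> (c * t) \<omega>)" for c \<omega>
  define Y where "Y c \<omega> = (\<lambda>t\<in>{0..}. W \<i> c t \<omega>)" for c \<omega>
  have X_meas: "X c \<in> M \<rightarrow>\<^sub>M borel_of skorohod_topology" if c: "0 < c" for c
    unfolding X_def
  proof (rule cadlag_process_measurable)
    show "(\<lambda>\<omega>. c powr (- 1 / \<alpha>) * \<theta> (c * t) \<omega>) \<in> borel_measurable M" if "0 \<le> t" for t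
      using \<theta>(1)[of "c * t"] c that by (intro borel_measurable_times borel_measurable_const) auto
    show "cadlag (\<lambda>t. c powr (- 1 / \<alpha>) * \<theta> (c * t) \<omega>)" if "\<omega> \<in> space M" for \<omega>
      using \<theta>(2)[OF that] c
      by (rule cadlag_rescale[where f = "\<lambda>y. c powr (- 1 / \<alpha>) * y"]) (intro continuous_intros)
  qed
  have Y_meas: "Y c \<in> M \<rightarrow>\<^sub>M borel_of skorohod_topology" if "0 < c" for c
    unfolding Y_def using W_meas[OF that] W_cad[OF that] by (rule cadlag_process_measurable)
  have Y_law: "distr M (borel_of skorohod_topology) (Y c) = \<mu>" if c: "0 < c" for c
    unfolding Y_def \<mu>_def \<zeta>_def using W_meas[OF c] W_cad[OF c] N_meas N_cad
    by (rule skorohod_law_of_path_law) (simp_all add: W_law[OF c] N_law)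

  \<comment> \<open>Off the event that a rescaled coordinate exceeds \<open>K\<close> in size before the time \<open>T\<close>, whose probability
    does not depend on \<open>c\<close>, the point stays within \<open>2 K a\<close> of \<open>1\<close>, where \<open>a = c\<^sup>1\<^sup>/\<^sup>\<alpha>\<close>. There the
    winding angle is linear up to \<open>2 (2 K a)\<^sup>2\<close>, which is \<open>8 K\<^sup>2 a\<close> after rescaling.\<close>
  have close: "\<forall>\<^sub>F c in at_right 0. \<exists>A\<in>sets M. measure M A \<le> \<eta> \<and>
      (\<forall>\<omega>\<in>space M - A. skorohod_dist (X c \<omega>) (Y c \<omega>) < \<delta>)" if \<delta>: "0 < \<delta>" and \<eta>: "0 < \<eta>" for \<delta> \<eta>
  proof -
    obtain T where T: "(1/2 :: real) ^ T < \<delta>/2" using real_arch_pow_inv[of "\<delta>/2" "1/2"] \<delta> by auto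
    obtain K where K: "0 < K" "measure M (exceeds (W \<i> 1) T K \<inter> space M) < \<eta>/2"
      using exceeds_tail[of M "W \<i> 1" "\<eta>/2" T] Z.prob_space_axioms W_meas W_cad \<eta> by (metis half_gt_zero zero_less_one)
    have K_prob: "measure M (exceeds (W v c) T K \<inter> space M) < \<eta>/2" if "0 < c" "norm v = 1" for v c
    proof -
      have "measure M (exceeds (W v c) T K \<inter> space M) = measure M (exceeds (W \<i> 1) T K \<inter> space M)"
        using measure_exceeds_path_law[of "W v c" M T K] measure_exceeds_path_law[of "W \<i> 1" M T K]
        by (simp add: W_meas that W_law[OF that])
      with K(2) show ?thesis by simp
    qed
    have lim: "((\<lambda>c. c powr (1/\<alpha>)) \<longlongrightarrow> 0) (at_right 0)"
    proof -
      have "((\<lambda>c. c powr (1/\<alpha>)) \<longlongrightarrow> 0 powr (1/\<alpha>)) (at_right 0)"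
        using assms(1) by (intro tendsto_powr2 tendsto_intros) (auto simp: eventually_at_right_field intro: exI[of _ 1])
      then show ?thesis by simp
    qed
    have small: "\<forall>\<^sub>F c in at_right 0. b * c powr (1/\<alpha>) < r" if "0 < r" for b r :: real
      using tendsto_mult[OF tendsto_const lim, of b] by (rule order_tendstoD(2)) (use that in simp)
    have "\<forall>\<^sub>F c in at_right 0. 8 * K\<^sup>2 * c powr (1/\<alpha>) < \<delta>/2" "\<forall>\<^sub>F c in at_right 0. 2 * K * c powr (1/\<alpha>) < 1/2"
      using \<delta> by (intro small; simp)+
    with eventually_at_right_less[of "0::real"] show ?thesis
    proof eventually_elim
      case (elim c)
      define a where "a = c powr (1/\<alpha>)"
      have a: "0 < a" "c powr (- 1 / \<alpha>) = 1 / a" "8 * K\<^sup>2 * a < \<delta>/2" "2 * K * a < 1/2"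
        using elim by (auto simp: a_def powr_minus_divide)
      define A where "A = E \<union> (exceeds (W 1 c) T K \<inter> space M) \<union> (exceeds (W \<i> c) T K \<inter> space M)"
      have ex: "exceeds (W v c) T K \<inter> space M \<in> sets M" for v
        by (intro sets_exceeds W_meas elim)
      have A: "A \<in> sets M" unfolding A_def using E ex by auto
      have "measure M A \<le> measure M E + measure M (exceeds (W 1 c) T K \<inter> space M) + measure M (exceeds (W \<i> c) T K \<inter> space M)"
        unfolding A_def using E ex
        by (intro order_trans[OF measure_Un_le] add_right_mono measure_Un_le) auto
      also have "\<dots> \<le> \<eta>"
        using K_prob[of c 1] K_prob[of c \<i>] elim E by (simp add: measure_eq_0_null_sets)
      finally have "measure M A \<le> \<eta>" .
      moreover have "skorohod_dist (X c \<omega>) (Y c \<omega>) < \<delta>" if w: "\<omega> \<in> space M - A" for \<omega>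
      proof -
        have cad: "cadlag (\<lambda>t. Z t \<omega>)" and wind: "winding_of (\<lambda>t. Z t \<omega>) (\<lambda>t. \<theta> t \<omega>)"
          and nE: "\<omega> \<notin> E" using off[of \<omega>] w by (auto simp: A_def)
        have WK: "\<bar>W v c t \<omega>\<bar> \<le> K" if "v \<in> {1, \<i>}" "0 \<le> t" "t < real T" for v t
          using w that elim W_cad
          by (intro abs_le_of_not_exceeds[where T = T]) (auto simp: A_def)
        have near: "cmod (Z (c * t) \<omega> - 1) \<le> 2 * K * a" if t: "0 \<le> t" "t < real T" for t
        proof -
          define y where "y = Z (c * t) \<omega> - 1"
          have "\<bar>Re y\<bar> = a * \<bar>W 1 c t \<omega>\<bar>" "\<bar>Im y\<bar> = a * \<bar>W \<i> c t \<omega>\<bar>"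
            using a nE by (simp_all add: W_def y_def inner_complex_def abs_mult)
          then have "\<bar>Re y\<bar> \<le> a * K" "\<bar>Im y\<bar> \<le> a * K"
            using WK[of 1 t] WK[of \<i> t] t a by simp_all
          then have "cmod y \<le> 2 * (a * K)" using cmod_le[of y] by linarith
          then show ?thesis by (simp add: y_def mult_ac)
        qed
        have "\<bar>X c \<omega> t - Y c \<omega> t\<bar> \<le> 8 * K\<^sup>2 * a" if t: "0 \<le> t" "t < real T" for t
        proof -
          have "\<bar>\<theta> (c * t) \<omega> - Im (Z (c * t) \<omega> - 1)\<bar> \<le> 2 * (2 * K * a)\<^sup>2"
          proof (rule abs_winding_diff_Im_le[OF wind cad])
            fix u assume u: "u \<in> {0..c * t}"
            then have "0 \<le> u / c" "u / c < real T" using elim t by (auto simp: field_simps intro: le_less_trans)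
            from near[OF this] show "cmod (Z u \<omega> - 1) \<le> 2 * K * a" using elim by simp
          qed (use elim t a in auto)
          moreover have "\<bar>X c \<omega> t - Y c \<omega> t\<bar> = \<bar>\<theta> (c * t) \<omega> - Im (Z (c * t) \<omega> - 1)\<bar> / a"
            using t nE a by (simp add: X_def Y_def W_def inner_complex_def diff_divide_distrib[symmetric])
          ultimately have "\<bar>X c \<omega> t - Y c \<omega> t\<bar> \<le> 2 * (2 * K * a)\<^sup>2 / a"
            using a by (simp add: divide_right_mono)
          also have "\<dots> = 8 * K\<^sup>2 * a" using a by (simp add: power2_eq_square)
          finally show ?thesis .
        qed
        then have "skorohod_dist (X c \<omega>) (Y c \<omega>) \<le> 8 * K\<^sup>2 * a + (1/2) ^ T"
          using a by (intro skorohod_dist_le_uniform) auto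
        then show ?thesis using a T by linarith
      qed
      ultimately show ?case using A by blast
    qed
  qed
  have "weakly_converges skorohod_topology (\<lambda>c. distr M (borel_of skorohod_topology) (X c)) \<mu> (at_right 0)"
    unfolding skorohod_topology_def
  proof (rule S.weakly_converges_of_close)
    show "\<forall>\<^sub>F c in at_right 0. X c \<in> M \<rightarrow>\<^sub>M borel_of S.mtopology"
      using eventually_at_right_less by eventually_elim (use X_meas in \<open>simp add: skorohod_topology_def\<close>)
    show "\<forall>\<^sub>F c in at_right 0. Y c \<in> M \<rightarrow>\<^sub>M borel_of S.mtopology \<and> distr M (borel_of S.mtopology) (Y c) = \<mu>"
      using eventually_at_right_less
      by eventually_elim (use Y_meas Y_law in \<open>simp add: skorohod_topology_def\<close>)
  qed (use Z.prob_space_axioms \<mu> close in \<open>auto simp: skorohod_topology_def\<close>)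
  moreover have "\<forall>\<^sub>F c in at_right 0. X c \<in> M \<rightarrow>\<^sub>M borel_of skorohod_topology"
    using eventually_at_right_less by eventually_elim (rule X_meas)
  ultimately have "converges_in_distribution skorohod_topology M X N (\<lambda>w. \<lambda>t\<in>{0..}. \<zeta> t w) (at_right 0)"
    using \<zeta> by (simp add: converges_in_distribution_def \<mu>_def)
  with stable show ?thesis
    unfolding X_def by (intro exI[of _ 1] conjI exI[of _ N] exI[of _ \<zeta>]) auto
qed

end
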